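(* Let $D=(V,A)$ be a digraph (parallel arcs allowed), $\{S,T\}$ a partition of $V$ with $S,T\neq\emptyset$ such that $D$ has no arc from $T$ to $S$, and $b\in\mathbb{Z}_{>0}^V$. Then the maximum number of pairwise arc-disjoint $b$-bibranchings in $D$ equals the minimum of the three quantities $$\min_{v\in T}\left\lfloor \frac{d^-_A(v)}{b(v)}\right\rfloor,\qquad \min_{v\in S}\left\lfloor \frac{d^+_A(v)}{b(v)}\right\rfloor,\qquad \min\{|C|: C\text{ a bicut}\}.$$
   Context: Digraphs are loopless. $d^-_B(v)$, $d^+_B(v)$ are the numbers of arcs of $B\subseteq A$ entering/leaving $v$; $\delta^-(U)$ is the set of arcs of $A$ entering $U$. A bicut is $\delta^-(U)$ for some $U$ with $\emptyset\neq U\subseteq T$ or $T\subseteq U\subsetneq V$. An arc set $B\subseteq A$ is a $b$-bibranching if (i) every vertex of $T$ is reachable in $(V,B)$ from some vertex of $S$, (ii) every vertex of $S$ reaches some vertex of $T$ in $(V,B)$, (iii) $d^-_B(v)\ge b(v)$ for all $v\in T$, and (iv) $d^+_B(u)\ge b(u)$ for all $u\in S$. *)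

theory Defs
  imports Main
begin

definition digraph :: "'v set \<Rightarrow> 'e set \<Rightarrow> ('e \<Rightarrow> 'v) \<Rightarrow> ('e \<Rightarrow> 'v) \<Rightarrow> bool" where
  "digraph V A tail head \<longleftrightarrow> finite V \<and> finite A \<and>
     (\<forall>e\<in>A. tail e \<in> V \<and> head e \<in> V \<and> tail e \<noteq> head e)"

definition indeg :: "'e set \<Rightarrow> ('e \<Rightarrow> 'v) \<Rightarrow> 'v \<Rightarrow> nat" where
  "indeg B head v = card {e\<in>B. head e = v}"

definition outdeg :: "'e set \<Rightarrow> ('e \<Rightarrow> 'v) \<Rightarrow> 'v \<Rightarrow> nat" where
  "outdeg B tail v = card {e\<in>B. tail e = v}"

definition delta_in :: "'e set \<Rightarrow> ('e \<Rightarrow> 'v) \<Rightarrow> ('e \<Rightarrow> 'v) \<Rightarrow> 'v set \<Rightarrow> 'e set" where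
  "delta_in A tail head U = {e\<in>A. tail e \<notin> U \<and> head e \<in> U}"

definition arc_rel :: "'e set \<Rightarrow> ('e \<Rightarrow> 'v) \<Rightarrow> ('e \<Rightarrow> 'v) \<Rightarrow> ('v \<times> 'v) set" where
  "arc_rel B tail head = {(tail e, head e) | e. e \<in> B}"

definition reach :: "'e set \<Rightarrow> ('e \<Rightarrow> 'v) \<Rightarrow> ('e \<Rightarrow> 'v) \<Rightarrow> 'v \<Rightarrow> 'v \<Rightarrow> bool" where
  "reach B tail head u v \<longleftrightarrow> (u, v) \<in> (arc_rel B tail head)\<^sup>*"

definition bicut_set :: "'v set \<Rightarrow> 'v set \<Rightarrow> 'v set \<Rightarrow> bool" where
  "bicut_set V T U \<longleftrightarrow> (U \<noteq> {} \<and> U \<subseteq> T) \<or> (T \<subseteq> U \<and> U \<subset> V)"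

definition b_bibranching ::
  "'v set \<Rightarrow> 'v set \<Rightarrow> 'e set \<Rightarrow> ('e \<Rightarrow> 'v) \<Rightarrow> ('e \<Rightarrow> 'v) \<Rightarrow> ('v \<Rightarrow> nat) \<Rightarrow> 'e set \<Rightarrow> bool" where
  "b_bibranching S T A tail head b B \<longleftrightarrow> B \<subseteq> A \<and>
     (\<forall>v\<in>T. \<exists>s\<in>S. reach B tail head s v) \<and>
     (\<forall>u\<in>S. \<exists>t\<in>T. reach B tail head u t) \<and>
     (\<forall>v\<in>T. indeg B head v \<ge> b v) \<and>
     (\<forall>u\<in>S. outdeg B tail u \<ge> b u)"

definition has_disjoint_bibranchings ::
  "'v set \<Rightarrow> 'v set \<Rightarrow> 'e set \<Rightarrow> ('e \<Rightarrow> 'v) \<Rightarrow> ('e \<Rightarrow> 'v) \<Rightarrow> ('v \<Rightarrow> nat) \<Rightarrow> nat \<Rightarrow> bool" where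
  "has_disjoint_bibranchings S T A tail head b k \<longleftrightarrow>
     (\<exists>Bs :: nat \<Rightarrow> 'e set. (\<forall>i<k. b_bibranching S T A tail head b (Bs i)) \<and>
        (\<forall>i<k. \<forall>j<k. i \<noteq> j \<longrightarrow> Bs i \<inter> Bs j = {}))"

end

theory Submission
  imports Defs Complex_Main
begin

text \<open>
  The arcs from \<open>S\<close> to \<open>T\<close> are first coloured with \<open>k\<close> colours by Schrijver's supermodular
  colouring theorem, so that (i) for every nonempty \<open>U \<subseteq> T\<close> the number of colours entering \<open>U\<close> plus the
  number of arcs inside \<open>T\<close> entering \<open>U\<close> is at least \<open>k\<close>, (ii) at every vertex of \<open>T\<close> the colours are
  balanced, and symmetrically for \<open>S\<close>.  By (i), Edmonds' theorem completes the colour classes inside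
  \<open>T\<close> by disjoint branchings rooted at the heads of the coloured arcs; by (ii), the remaining arcs
  suffice to raise all indegrees to \<open>b\<close>.  The same is done in \<open>S\<close> with all arcs reversed.
  The colouring theorem is proved one colour class at a time: a class is an integral point
  of the intersection of two generalised polymatroids which contains the constant vector \<open>1/k\<close>.
\<close>

subsection \<open>Vertices of polytopes\<close>

text \<open>Only the arcs from \<open>S\<close> to \<open>T\<close> serve both sides. Once they are
  coloured, the two completions are independent, so a colouring theorem for two families of demands
  is just enough: one family per side. The obstacle is that each side asks for two things, cuts and
  degrees, which have to be merged into a single intersecting supermodular family. This is why
  balance at a vertex \<open>v\<close> is expressed by \<open>b v\<close> disjoint blocks of arcs at
  \<open>v\<close>: a block is contained in every cut set that it meets, so it uncrosses trivially.
  A cut at \<open>U\<close> inside \<open>T\<close> demands \<open>k\<close> minus the number of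
  arcs inside \<open>T\<close> that enter \<open>U\<close>; the bicut bound says exactly that this
  demand does not exceed the number of arcs available to meet it. The constraints on a single colour
  class come from what must remain feasible afterwards. If \<open>Y\<close> demands \<open>p\<close>
  colours, a class may take at most \<open>card Y - p + 1\<close> elements of \<open>Y\<close>, so
  that \<open>p - 1\<close> are left for the other colours; and it must meet every \<open>Y\<close>
  with demand \<open>k\<close>, as \<open>k - 1\<close> further colours cannot supply
  \<open>k\<close>.\<close>

lemma homogeneous_system_nontrivial:
  fixes a :: "'j \<Rightarrow> 'e \<Rightarrow> 'a::field"
  assumes "finite I" "finite F" "card I < card F"
  shows "\<exists>d. (\<exists>e\<in>F. d e \<noteq> 0) \<and> (\<forall>i\<in>I. (\<Sum>e\<in>F. a i e * d e) = 0)"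
  using assms
proof (induction I arbitrary: F a rule: finite_induct)
  case empty
  then obtain e where "e \<in> F" by fastforce
  then show ?case by (intro exI[of _ "\<lambda>_. 1"]) auto
next
  case (insert j I)
  show ?case
  proof (cases "\<forall>e\<in>F. a j e = 0")
    case True
    have "card I < card F" using insert by simp
    from insert.IH[OF insert.prems(1) this, of a] obtain d where
      "\<exists>e\<in>F. d e \<noteq> 0" "\<forall>i\<in>I. (\<Sum>e\<in>F. a i e * d e) = 0" by blast
    with True show ?thesis by (intro exI[of _ d]) simp
  next
    case False
    then obtain e0 where e0: "e0 \<in> F" "a j e0 \<noteq> 0" by blast
    let ?F = "F - {e0}"
    \<comment> \<open>Gaussian elimination with pivot \<open>e0\<close>: the unknown
      \<open>e0\<close> disappears from the other equations, and its value is then read off equation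
      \<open>j\<close>.\<close>
    let ?a = "\<lambda>i e. a i e - a i e0 / a j e0 * a j e"
    have "finite ?F" "card I < card ?F" using insert e0 by auto
    from insert.IH[OF this, of ?a] obtain d where
      d: "\<exists>e\<in>?F. d e \<noteq> 0" "\<And>i. i \<in> I \<Longrightarrow> (\<Sum>e\<in>?F. ?a i e * d e) = 0" by blast
    let ?s = "\<Sum>e\<in>?F. a j e * d e"
    let ?d = "d(e0 := - ?s / a j e0)"
    have split: "(\<Sum>e\<in>F. a i e * ?d e) = a i e0 * (- ?s / a j e0) + (\<Sum>e\<in>?F. a i e * d e)" for i
      using insert.prems(1) e0(1) by (simp add: sum.remove[of F e0])
    have "(\<Sum>e\<in>F. a i e * ?d e) = 0" if "i \<in> insert j I" for i
    proof (cases "i = j")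
      case True
      then show ?thesis using split[of j] e0 by simp
    next
      case False
      with that have "(\<Sum>e\<in>?F. ?a i e * d e) = 0" using d(2) by blast
      moreover have "(\<Sum>e\<in>?F. ?a i e * d e) = (\<Sum>e\<in>?F. a i e * d e) - a i e0 / a j e0 * ?s"
        by (simp add: left_diff_distrib sum_subtractf sum_distrib_left mult.assoc)
      ultimately show ?thesis using split[of i] by simp
    qed
    moreover have "\<exists>e\<in>F. ?d e \<noteq> 0" using d(1) by auto
    ultimately show ?thesis by blast
  qed
qed

text \<open>The ratio test of the simplex method: \<open>f\<close> are slacks and \<open>g\<close>
  their rates of change. Stopping at the first moment at which a decreasing slack vanishes keeps all
  slacks nonnegative and adds a tight constraint.\<close>

lemma step_until_tight:
  fixes f g :: "'j \<Rightarrow> real"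
  assumes fin: "finite I" and nonneg: "\<And>j. j \<in> I \<Longrightarrow> f j \<ge> 0"
    and tight: "\<And>j. j \<in> I \<Longrightarrow> f j = 0 \<Longrightarrow> g j = 0"
    and neg: "\<exists>j\<in>I. g j < 0"
  shows "\<exists>t. (\<forall>j\<in>I. f j + t * g j \<ge> 0) \<and> {j\<in>I. f j = 0} \<subset> {j\<in>I. f j + t * g j = 0}"
proof -
  let ?N = "{j\<in>I. g j < 0}"
  let ?r = "\<lambda>j. f j / (- g j)"
  define t where "t = Min (?r ` ?N)"
  have fin': "finite (?r ` ?N)" "?r ` ?N \<noteq> {}" using fin neg by auto
  have "t \<in> ?r ` ?N" unfolding t_def using fin' by (rule Min_in)
  then obtain j0 where j0: "j0 \<in> ?N" "t = ?r j0" by blast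
  have t0: "t \<ge> 0" using j0 nonneg[of j0] by (simp add: divide_nonneg_neg)
  have "f j + t * g j \<ge> 0" if "j \<in> I" for j
  proof (cases "g j < 0")
    case True
    then have "t \<le> ?r j" using that fin' t_def by auto
    then show ?thesis using True by (simp add: field_simps)
  next
    case False
    then show ?thesis using nonneg[OF that] t0 by (simp add: not_less)
  qed
  moreover have "f j0 + t * g j0 = 0" "f j0 \<noteq> 0"
    using j0 tight[of j0] by (auto simp: field_simps)
  then have "{j\<in>I. f j = 0} \<subset> {j\<in>I. f j + t * g j = 0}" using j0(1) tight by auto
  ultimately show ?thesis by blast
qed

text \<open>A triple \<open>(s, Y, c)\<close> encodes the constraint \<open>s * x(Y) + c \<ge> 0\<close>.\<close>

lemma vertex_exists:
  fixes Q :: "(real \<times> 'e set \<times> real) set" and x0 :: "'e \<Rightarrow> real"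
  assumes fin: "finite Q"
    and box: "\<And>e. e \<in> X \<Longrightarrow> (1, {e}, 0) \<in> Q \<and> (-1, {e}, 1) \<in> Q"
    and feas: "\<And>s Y c. (s, Y, c) \<in> Q \<Longrightarrow> s * sum x0 Y + c \<ge> 0"
  obtains x where "\<And>s Y c. (s, Y, c) \<in> Q \<Longrightarrow> s * sum x Y + c \<ge> 0"
    and "\<And>d e. (\<And>s Y c. (s, Y, c) \<in> Q \<Longrightarrow> s * sum x Y + c = 0 \<Longrightarrow> sum d Y = 0)
           \<Longrightarrow> e \<in> X \<Longrightarrow> d e = (0::real)"
proof -
  define sl where "sl x q = (case q of (s, Y, c) \<Rightarrow> s * sum x Y + c)" for x :: "'e \<Rightarrow> real" and q
  define P where "P x \<longleftrightarrow> (\<forall>q\<in>Q. sl x q \<ge> 0)" for x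
  define m where "m x = card {q\<in>Q. sl x q = 0}" for x
  have "P x0" using feas by (auto simp: P_def sl_def)
  moreover have "\<And>y. P y \<Longrightarrow> m y < card Q + 1"
    using fin by (auto simp: m_def less_Suc_eq_le intro!: card_mono)
  \<comment> \<open>A feasible point with the greatest number of tight constraints plays the part of
    a vertex.\<close>
  ultimately have "\<exists>x. P x \<and> (\<forall>y. P y \<longrightarrow> m y \<le> m x)"
    using ex_has_greatest_nat[of P x0 m "card Q + 1"] less_imp_le by metis
  then obtain x where x: "P x" "\<And>y. P y \<Longrightarrow> m y \<le> m x" by blast
  show ?thesis
  proof
    show "s * sum x Y + c \<ge> 0" if "(s, Y, c) \<in> Q" for s Y c
      using x(1) that by (auto simp: P_def sl_def)
  next
    fix d :: "'e \<Rightarrow> real" and e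
    assume d: "\<And>s Y c. (s, Y, c) \<in> Q \<Longrightarrow> s * sum x Y + c = 0 \<Longrightarrow> sum d Y = 0" and e: "e \<in> X"
    show "d e = 0"
    proof (rule ccontr)
      assume ne: "d e \<noteq> 0"
      define g where "g q = (case q of (s, Y, c :: real) \<Rightarrow> s * sum d Y)" for q
      \<comment> \<open>Both bounds on \<open>x e\<close> are constraints, so some slack decreases
        along \<open>d\<close> whatever the sign of \<open>d e\<close>; there is no need to pass to
        the opposite direction.\<close>
      have "\<exists>q\<in>Q. g q < 0"
      proof (cases "d e < 0")
        case True
        then show ?thesis using box[OF e] by (intro bexI[of _ "(1, {e}, 0)"]) (auto simp: g_def)
      next
        case False
        then show ?thesis using box[OF e] ne by (intro bexI[of _ "(-1, {e}, 1)"]) (auto simp: g_def)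
      qed
      moreover have "g q = 0" if "q \<in> Q" "sl x q = 0" for q
        using that d by (cases q) (auto simp: g_def sl_def)
      moreover have "sl x q \<ge> 0" if "q \<in> Q" for q using x(1) that by (simp add: P_def)
      ultimately have "\<exists>t. (\<forall>q\<in>Q. sl x q + t * g q \<ge> 0) \<and>
          {q\<in>Q. sl x q = 0} \<subset> {q\<in>Q. sl x q + t * g q = 0}"
        using fin by (intro step_until_tight)
      then obtain t where t: "\<forall>q\<in>Q. sl x q + t * g q \<ge> 0"
          "{q\<in>Q. sl x q = 0} \<subset> {q\<in>Q. sl x q + t * g q = 0}" by blast
      define y where "y f = x f + t * d f" for f
      have "sl y q = sl x q + t * g q" for q
        by (cases q) (simp add: sl_def g_def y_def sum.distrib sum_distrib_left algebra_simps)
      then have sl: "sl y = (\<lambda>q. sl x q + t * g q)" by blast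
      have "P y" using t(1) by (simp add: P_def sl)
      moreover have "m x < m y"
        unfolding m_def sl by (rule psubset_card_mono) (use fin t(2) in simp_all)
      ultimately show False using x(2) by fastforce
    qed
  qed
qed

section \<open>Intersecting families and the linear systems they define\<close>

definition intersecting :: "'e set set \<Rightarrow> bool" where
  "intersecting L \<longleftrightarrow> (\<forall>P\<in>L. \<forall>Q\<in>L. P \<inter> Q \<noteq> {} \<longrightarrow> P \<inter> Q \<in> L \<and> P \<union> Q \<in> L)"

text \<open>Two maximal members that meet would have their union as a larger member. Hence the
  maximal members are disjoint, and they cover the same elements as \<open>N\<close>.\<close>

lemma intersecting_Union_integral:
  fixes x :: "'e \<Rightarrow> real"
  assumes fin: "finite N" "\<And>Q. Q \<in> N \<Longrightarrow> finite Q"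
    and un: "\<And>P Q. P \<in> N \<Longrightarrow> Q \<in> N \<Longrightarrow> P \<inter> Q \<noteq> {} \<Longrightarrow> P \<union> Q \<in> N"
    and int: "\<And>Q. Q \<in> N \<Longrightarrow> sum x Q \<in> \<int>"
  shows "sum x (\<Union>N) \<in> \<int>"
proof -
  let ?M = "{Q\<in>N. \<forall>R\<in>N. Q \<subseteq> R \<longrightarrow> Q = R}"
  have "\<exists>R\<in>?M. Q \<subseteq> R" if "Q \<in> N" for Q
    using finite_has_maximal2[OF fin(1) that] by blast
  then have "\<Union>N = \<Union>?M" by blast
  moreover have "sum x (\<Union>?M) = sum (sum x) ?M"
  proof (subst sum.Union_disjoint)
    show "\<forall>A\<in>?M. \<forall>B\<in>?M. A \<noteq> B \<longrightarrow> A \<inter> B = {}"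
    proof (intro ballI impI, rule ccontr)
      fix A B assume AB: "A \<in> ?M" "B \<in> ?M" "A \<noteq> B" "A \<inter> B \<noteq> {}"
      then have "A \<in> N" "B \<in> N" by simp_all
      then have u: "A \<union> B \<in> N" using un AB(4) by simp
      have "\<forall>R\<in>N. A \<subseteq> R \<longrightarrow> A = R" "\<forall>R\<in>N. B \<subseteq> R \<longrightarrow> B = R" using AB(1,2) by simp_all
      from this(1)[rule_format, OF u Un_upper1] this(2)[rule_format, OF u Un_upper2]
      have "A = A \<union> B" "B = A \<union> B" .
      then show False using AB(3) by blast
    qed
  qed (use fin in auto)
  moreover have "sum (sum x) ?M \<in> \<int>" by (rule Ints_sum) (use int in simp)
  ultimately show ?thesis by simp
qed

text \<open>The classes are the atoms of \<open>L\<close>: two elements are equivalent when they lie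
  in the same members. An atom is a smallest member minus a union of members, so its
  \<open>x\<close>-sum is integral; no single entry is integral, hence an atom has at least two
  elements. Members are disjoint unions of atoms, so the equations for the atoms imply those for
  \<open>L\<close>.\<close>

lemma intersecting_classes:
  fixes x :: "'e \<Rightarrow> real"
  assumes finF: "finite F" and sub: "\<And>P. P \<in> L \<Longrightarrow> P \<subseteq> F" and L: "intersecting L"
    and int: "\<And>P. P \<in> L \<Longrightarrow> sum x P \<in> \<int>"
    and frac: "\<And>e. e \<in> F \<Longrightarrow> x e \<notin> \<int>"
  obtains \<C> where "\<Union>\<C> = \<Union>L" "pairwise disjnt \<C>" "\<forall>C\<in>\<C>. card C \<ge> 2"
    "\<forall>d :: 'e \<Rightarrow> real. (\<forall>C\<in>\<C>. sum d C = 0) \<longrightarrow> (\<forall>P\<in>L. sum d P = 0)"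
proof -
  have finL: "finite L" using finite_subset[of L "Pow F"] sub finF by auto
  have finP: "finite P" if "P \<in> L" for P using sub[OF that] finF finite_subset by blast
  define cl where "cl e = {f\<in>\<Union>L. \<forall>P\<in>L. e \<in> P \<longleftrightarrow> f \<in> P}" for e
  define \<C> where "\<C> = cl ` \<Union>L"
  have self: "e \<in> cl e" if "e \<in> \<Union>L" for e using that by (auto simp: cl_def)
  have clsub: "cl e \<subseteq> \<Union>L" for e by (auto simp: cl_def)
  have same: "cl e = cl f" if "g \<in> cl e" "g \<in> cl f" for e f g 
  proof -
    have "\<forall>P\<in>L. e \<in> P \<longleftrightarrow> f \<in> P" using that by (simp add: cl_def)
    then show ?thesis unfolding cl_def by (intro Collect_cong) simp
  qed
  have disj: "pairwise disjnt \<C>"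
    unfolding pairwise_def disjnt_def \<C>_def using same by blast
  have un: "\<Union>\<C> = \<Union>L" using self clsub by (auto simp: \<C>_def)
  have finUn: "finite (\<Union>L)" using finL finP by blast
  have finC: "finite C" if "C \<in> \<C>" for C
    using that un finUn by (metis Union_upper finite_subset)
  have card2: "card (cl e) \<ge> 2" if e: "e \<in> \<Union>L" for e
  proof -
    obtain P where P: "P \<in> L" "e \<in> P" "\<And>Q. Q \<in> L \<Longrightarrow> e \<in> Q \<Longrightarrow> card P \<le> card Q"
      using e ex_has_least_nat[of "\<lambda>P. P \<in> L \<and> e \<in> P" _ card] by blast
    have Pmin: "P \<subseteq> Q" if "Q \<in> L" "e \<in> Q" for Q
    proof -
      have "P \<inter> Q \<in> L" using L P that by (auto simp: intersecting_def)
      then have "card P \<le> card (P \<inter> Q)" using P that by blast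
      then have "P \<inter> Q = P" using finP[OF P(1)] by (metis card_seteq inf_le1)
      then show ?thesis by blast
    qed
    \<comment> \<open>An element \<open>f\<close> of \<open>P\<close> is separated from
      \<open>e\<close> exactly by these sets: if a member \<open>R\<close> contains \<open>f\<close>
      but not \<open>e\<close>, then so does \<open>R \<inter> P\<close>, which is again a member
      because it contains \<open>f\<close>.\<close>
    define N where "N = {Q\<in>L. Q \<subseteq> P \<and> e \<notin> Q}"
    have "cl e = P - \<Union>N"
    proof (rule set_eqI)
      fix f
      have "f \<in> cl e" if f: "f \<in> P" "f \<notin> \<Union>N"
      proof -
        have "e \<in> R" if R: "R \<in> L" "f \<in> R" for R
        proof (rule ccontr)
          assume "e \<notin> R"
          moreover have "R \<inter> P \<in> L" using L P(1) R f(1) by (auto simp: intersecting_def)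
          ultimately show False using f R by (auto simp: N_def)
        qed
        then show ?thesis using f(1) P(1) Pmin by (auto simp: cl_def)
      qed
      then show "f \<in> cl e \<longleftrightarrow> f \<in> P - \<Union>N" using P(1,2) by (auto simp: cl_def N_def)
    qed
    moreover have "sum x (\<Union>N) \<in> \<int>"
    proof (rule intersecting_Union_integral)
      show "finite N" using finL by (simp add: N_def)
      show "A \<union> B \<in> N" if "A \<in> N" "B \<in> N" "A \<inter> B \<noteq> {}" for A B
        using that L by (auto simp: N_def intersecting_def)
    qed (use finP int in \<open>auto simp: N_def\<close>)
    moreover have "\<Union>N \<subseteq> P" by (auto simp: N_def)
    ultimately have "sum x (cl e) \<in> \<int>"
      using int[OF P(1)] finP[OF P(1)] by (simp add: sum_diff)
    moreover have "x e \<notin> \<int>" using e frac sub by blast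
    ultimately have "cl e \<noteq> {e}" by auto
    moreover have "finite (cl e)" using clsub finUn finite_subset by blast
    ultimately have "\<not> card (cl e) \<le> Suc 0"
      using self[OF e] card_le_Suc0_iff_eq[of "cl e"] by blast
    then show ?thesis by simp
  qed
  show ?thesis
  proof
    show "\<Union>\<C> = \<Union>L" by (fact un)
    show "pairwise disjnt \<C>" by (fact disj)
    show "\<forall>C\<in>\<C>. card C \<ge> 2" using card2 by (auto simp: \<C>_def)
    show "\<forall>d :: 'e \<Rightarrow> real. (\<forall>C\<in>\<C>. sum d C = 0) \<longrightarrow> (\<forall>P\<in>L. sum d P = 0)"
    proof (intro allI impI ballI)
      fix d :: "'e \<Rightarrow> real" and P
      assume d: "\<forall>C\<in>\<C>. sum d C = 0" and P: "P \<in> L"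
      let ?M = "{C\<in>\<C>. C \<subseteq> P}"
      have "cl e \<subseteq> P" if "e \<in> P" for e using that P by (auto simp: cl_def)
      then have "P = \<Union>?M" using P self unfolding \<C>_def by blast
      moreover have "sum d (\<Union>?M) = sum (sum d) ?M"
        by (subst sum.Union_disjoint) (use finC disj in \<open>auto simp: pairwise_def disjnt_def\<close>)
      ultimately show "sum d P = 0" using d by simp
    qed
  qed
qed

lemma sum_Union_pairwise_disjnt:
  assumes "finite (\<Union>\<C>)" "pairwise disjnt \<C>"
  shows "sum d (\<Union>\<C>) = sum (sum d) \<C>"
proof -
  have "finite C" if "C \<in> \<C>" for C using that assms(1) by (metis Union_upper finite_subset)
  then show ?thesis
    using assms(2) by (subst sum.Union_disjoint) (auto simp: pairwise_def disjnt_def)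
qed

lemma card_partition_blocks_ge_2:
  assumes "finite (\<Union>\<C>)" "pairwise disjnt \<C>" "\<And>C. C \<in> \<C> \<Longrightarrow> card C \<ge> 2"
  shows "2 * card \<C> \<le> card (\<Union>\<C>)"
proof -
  have "finite C" if "C \<in> \<C>" for C using that assms(1) by (metis Union_upper finite_subset)
  then have "card (\<Union>\<C>) = sum card \<C>" using assms(2) by (intro card_Union_disjoint) auto
  also have "\<dots> \<ge> sum (\<lambda>_. 2) \<C>" using assms(3) by (intro sum_mono) auto
  finally show ?thesis by simp
qed

text \<open>Counting: the classes of the two families give fewer independent equations than unknowns,
  because every class has two elements, and if both families cover \<open>F\<close> then one equation is
  implied by the others.\<close>

lemma two_intersecting_families_kernel:
  fixes x :: "'e \<Rightarrow> real"
  assumes finF: "finite F" "F \<noteq> {}"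
    and sub1: "\<And>P. P \<in> L1 \<Longrightarrow> P \<subseteq> F" and L1: "intersecting L1"
    and sub2: "\<And>P. P \<in> L2 \<Longrightarrow> P \<subseteq> F" and L2: "intersecting L2"
    and int1: "\<And>P. P \<in> L1 \<Longrightarrow> sum x P \<in> \<int>"
    and int2: "\<And>P. P \<in> L2 \<Longrightarrow> sum x P \<in> \<int>"
    and frac: "\<And>e. e \<in> F \<Longrightarrow> x e \<notin> \<int>"
  shows "\<exists>d :: 'e \<Rightarrow> real. (\<exists>e\<in>F. d e \<noteq> 0) \<and> (\<forall>P\<in>L1 \<union> L2. sum d P = 0)"
proof -
  obtain \<C>1 where C1: "\<Union>\<C>1 = \<Union>L1" "pairwise disjnt \<C>1" "\<forall>C\<in>\<C>1. card C \<ge> 2"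
    "\<forall>d :: 'e \<Rightarrow> real. (\<forall>C\<in>\<C>1. sum d C = 0) \<longrightarrow> (\<forall>P\<in>L1. sum d P = 0)"
    by (rule intersecting_classes[OF finF(1) sub1 L1 int1 frac])
  obtain \<C>2 where C2: "\<Union>\<C>2 = \<Union>L2" "pairwise disjnt \<C>2" "\<forall>C\<in>\<C>2. card C \<ge> 2"
    "\<forall>d :: 'e \<Rightarrow> real. (\<forall>C\<in>\<C>2. sum d C = 0) \<longrightarrow> (\<forall>P\<in>L2. sum d P = 0)"
    by (rule intersecting_classes[OF finF(1) sub2 L2 int2 frac])
  have s1: "\<Union>\<C>1 \<subseteq> F" and s2: "\<Union>\<C>2 \<subseteq> F" unfolding C1(1) C2(1) using sub1 sub2 by blast+
  have f1: "finite \<C>1" and f2: "finite \<C>2"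
    using finite_subset[OF s1 finF(1)] finite_subset[OF s2 finF(1)] by (auto dest: finite_UnionD)
  have c1: "2 * card \<C>1 \<le> card (\<Union>\<C>1)" and c2: "2 * card \<C>2 \<le> card (\<Union>\<C>2)"
    using finite_subset[OF s1 finF(1)] finite_subset[OF s2 finF(1)] C1(2,3) C2(2,3)
    by (simp_all add: card_partition_blocks_ge_2)
  \<comment> \<open>It suffices to find fewer than \<open>card F\<close> equations that imply the
    equations of all classes.\<close>
  have solve: ?thesis if I: "finite I" "card I < card F" "\<And>C. C \<in> I \<Longrightarrow> C \<subseteq> F"
    and imp: "\<And>(d :: 'e \<Rightarrow> real) C. (\<And>C. C \<in> I \<Longrightarrow> sum d C = 0) \<Longrightarrow> C \<in> \<C>1 \<union> \<C>2 \<Longrightarrow> sum d C = 0"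
    for I
  proof -
    obtain d :: "'e \<Rightarrow> real" where d: "\<exists>e\<in>F. d e \<noteq> 0"
      "\<And>C. C \<in> I \<Longrightarrow> (\<Sum>e\<in>F. of_bool (e \<in> C) * d e) = 0"
      using homogeneous_system_nontrivial[OF I(1) finF(1) I(2), of "\<lambda>C e. of_bool (e \<in> C)"] by blast
    have "sum d C = 0" if "C \<in> I" for C
    proof -
      have "(\<Sum>e\<in>F. of_bool (e \<in> C) * d e) = sum d C"
        using I(3)[OF that] finF(1) by (intro sum.mono_neutral_cong_right) auto
      then show ?thesis using d(2)[OF that] by simp
    qed
    then have "sum d C = 0" if "C \<in> \<C>1 \<union> \<C>2" for C using imp that by blast
    then have "sum d P = 0" if "P \<in> L1 \<union> L2" for P
      using that C1(4) C2(4) by blast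
    then show ?thesis using d(1) by blast
  qed
  have Csub: "C \<subseteq> F" if "C \<in> \<C>1 \<union> \<C>2" for C using that s1 s2 by blast
  show ?thesis
  proof (cases "\<Union>\<C>1 = F \<and> \<Union>\<C>2 = F")
    case True
    then obtain C0 where C0: "C0 \<in> \<C>2" using finF(2) by auto
    let ?I = "\<C>1 \<union> (\<C>2 - {C0})"
    have "card ?I \<le> card \<C>1 + (card \<C>2 - 1)"
      using card_Un_le[of \<C>1 "\<C>2 - {C0}"] C0 f2 by simp
    moreover have "card \<C>2 > 0" using C0 f2 by (auto simp: card_gt_0_iff)
    ultimately have lt: "card ?I < card F" using c1 c2 True by simp
    show ?thesis
    proof (rule solve[of ?I])
      fix d :: "'e \<Rightarrow> real" and C
      assume d: "\<And>C. C \<in> ?I \<Longrightarrow> sum d C = 0" and C: "C \<in> \<C>1 \<union> \<C>2"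
      have "sum d F = sum (sum d) \<C>1"
        using sum_Union_pairwise_disjnt[of \<C>1 d] C1(2) True finF(1) by simp
      also have "\<dots> = 0" using d by simp
      finally have "sum d F = 0" .
      moreover have "sum d F = sum (sum d) \<C>2"
        using sum_Union_pairwise_disjnt[of \<C>2 d] C2(2) True finF(1) by simp
      moreover have "sum (sum d) \<C>2 = sum d C0 + sum (sum d) (\<C>2 - {C0})"
        using C0 f2 by (simp add: sum.remove)
      moreover have "sum (sum d) (\<C>2 - {C0}) = 0" using d by simp
      ultimately have "sum d C0 = 0" by simp
      then show "sum d C = 0" using C d by blast
    qed (use lt f1 f2 Csub in auto)
  next
    case False
    \<comment> \<open>One family leaves an element of \<open>F\<close> uncovered, and this strict
      inequality does the work of the dropped equation.\<close>
    then have "card (\<Union>\<C>1) < card F \<or> card (\<Union>\<C>2) < card F"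
      using s1 s2 psubset_card_mono[OF finF(1)] by (metis psubsetI)
    moreover have "card (\<Union>\<C>1) \<le> card F" "card (\<Union>\<C>2) \<le> card F" using s1 s2 finF(1) by (auto intro: card_mono)
    ultimately have "card (\<C>1 \<union> \<C>2) < card F"
      using c1 c2 card_Un_le[of \<C>1 \<C>2] by linarith
    then show ?thesis using f1 f2 Csub by (intro solve[of "\<C>1 \<union> \<C>2"]) auto
  qed
qed

subsection \<open>Supermodular colouring\<close>

text \<open>A pair \<open>(Y, p)\<close> demands that \<open>Y\<close> meets at least \<open>p\<close> colour classes.\<close>

definition intersecting_supermodular :: "('e set \<times> int) set \<Rightarrow> bool" where
  "intersecting_supermodular G \<longleftrightarrow> (\<forall>Y p Z q. (Y, p) \<in> G \<longrightarrow> (Z, q) \<in> G \<longrightarrow> Y \<inter> Z \<noteq> {} \<longrightarrow>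
     (\<exists>r s. (Y \<inter> Z, r) \<in> G \<and> (Y \<union> Z, s) \<in> G \<and> p + q \<le> r + s))"

text \<open>Both bounds on \<open>p\<close> are necessary, since \<open>k\<close> disjoint classes
  can meet \<open>Y\<close> neither more than \<open>card Y\<close> nor more than \<open>k\<close>
  times. Demands form a relation, not a function of \<open>Y\<close>, because different vertex sets
  may be entered by the same coloured arcs.\<close>

definition colourable_demand :: "'e set \<Rightarrow> nat \<Rightarrow> ('e set \<times> int) set \<Rightarrow> bool" where
  "colourable_demand X k G \<longleftrightarrow> finite G \<and> intersecting_supermodular G \<and>
     (\<forall>(Y, p)\<in>G. Y \<subseteq> X \<and> p \<le> int (card Y) \<and> p \<le> int k)"

text \<open>Two sets which are tight
  for constraints of the same kind uncross as usual; a set tight for an upper bound is contained in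
  every set tight for a lower bound that it meets, up to elements with value 1.\<close>

lemma intersecting_tight_sets:
  fixes x :: "'e \<Rightarrow> real"
  assumes finX: "finite X" and G: "colourable_demand X k G"
    and x1: "\<And>e. e \<in> X \<Longrightarrow> x e \<le> 1"
    and up: "\<And>Y p. (Y, p) \<in> G \<Longrightarrow> sum x Y \<le> real (card Y) - p + 1"
    and lo: "\<And>Y. (Y, int k) \<in> G \<Longrightarrow> sum x Y \<ge> 1"
    and F: "F = {e\<in>X. x e \<notin> \<int>}"
    and L: "L = {Y \<inter> F | Y p. (Y, p) \<in> G \<and>
              (sum x Y = real (card Y) - p + 1 \<or> p = int k \<and> sum x Y = 1)}"
  shows "intersecting L" "\<And>P. P \<in> L \<Longrightarrow> sum x P \<in> \<int>"
proof -
  have sub: "Y \<subseteq> X" "p \<le> int (card Y)" "p \<le> int k" if "(Y, p) \<in> G" for Y p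
    using G that by (auto simp: colourable_demand_def)
  have fin: "finite Y" if "(Y, p) \<in> G" for Y p using sub[OF that] finX finite_subset by blast
  have sm: "\<exists>r s. (Y \<inter> Z, r) \<in> G \<and> (Y \<union> Z, s) \<in> G \<and> p + q \<le> r + s"
    if "(Y, p) \<in> G" "(Z, q) \<in> G" "Y \<inter> Z \<noteq> {}" for Y p Z q
    using G that unfolding colourable_demand_def intersecting_supermodular_def by blast
  define U where "U Y p \<longleftrightarrow> (Y, p) \<in> G \<and> sum x Y = real (card Y) - p + 1" for Y p
  define W where "W Y \<longleftrightarrow> (Y, int k) \<in> G \<and> sum x Y = 1" for Y
  have Leq: "P \<in> L \<longleftrightarrow> (\<exists>Y. ((\<exists>p. U Y p) \<or> W Y) \<and> P = Y \<inter> F)" for P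
    by (auto simp: L U_def W_def)
  have UU: "Y \<inter> Z \<inter> F \<in> L \<and> (Y \<union> Z) \<inter> F \<in> L" if h: "U Y p" "U Z q" "Y \<inter> Z \<noteq> {}" for Y p Z q
  proof -
    have YZ: "(Y, p) \<in> G" "(Z, q) \<in> G" using that by (auto simp: U_def)
    obtain r s where rs: "(Y \<inter> Z, r) \<in> G" "(Y \<union> Z, s) \<in> G" "p + q \<le> r + s"
      using sm[OF YZ h(3)] by blast
    have "sum x (Y \<union> Z) + sum x (Y \<inter> Z) = sum x Y + sum x Z"
      by (intro sum.union_inter fin[OF YZ(1)] fin[OF YZ(2)])
    moreover have "real (card (Y \<union> Z)) + real (card (Y \<inter> Z)) = real (card Y) + real (card Z)"
      using card_Un_Int[of Y Z] fin YZ by (metis of_nat_add)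
    moreover have "sum x (Y \<union> Z) \<le> real (card (Y \<union> Z)) - s + 1"
      "sum x (Y \<inter> Z) \<le> real (card (Y \<inter> Z)) - r + 1" using up rs by auto
    moreover have "real_of_int p + q \<le> r + s" using rs(3) by linarith
    \<comment> \<open>By supermodularity the bounds for \<open>Y \<inter> Z\<close> and
      \<open>Y \<union> Z\<close> add up to at most the tight values of \<open>Y\<close> and
      \<open>Z\<close>, so both must hold with equality.\<close>
    ultimately have "U (Y \<inter> Z) r" "U (Y \<union> Z) s" using rs that by (auto simp: U_def)
    then show ?thesis using Leq by blast
  qed
  have WW: "Y \<inter> Z \<inter> F \<in> L \<and> (Y \<union> Z) \<inter> F \<in> L" if h: "W Y" "W Z" "Y \<inter> Z \<noteq> {}" for Y Z
  proof -
    have YZ: "(Y, int k) \<in> G" "(Z, int k) \<in> G" using that by (auto simp: W_def)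
    obtain r s where rs: "(Y \<inter> Z, r) \<in> G" "(Y \<union> Z, s) \<in> G" "int k + int k \<le> r + s"
      using sm[OF YZ h(3)] by blast
    then have "r = int k" "s = int k" using sub(3)[OF rs(1)] sub(3)[OF rs(2)] by auto
    moreover have "sum x (Y \<union> Z) + sum x (Y \<inter> Z) = sum x Y + sum x Z"
      by (intro sum.union_inter fin[OF YZ(1)] fin[OF YZ(2)])
    ultimately have "W (Y \<inter> Z)" "W (Y \<union> Z)"
      using rs that lo[of "Y \<inter> Z"] lo[of "Y \<union> Z"] by (auto simp: W_def)
    then show ?thesis using Leq by blast
  qed
  have UW: "Y \<inter> F \<subseteq> Z" if h: "U Y p" "W Z" "Y \<inter> Z \<noteq> {}" for Y p Z
  proof -
    have YZ: "(Y, p) \<in> G" "(Z, int k) \<in> G" using that by (auto simp: U_def W_def)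
    obtain r s where rs: "(Y \<inter> Z, r) \<in> G" "(Y \<union> Z, s) \<in> G" "p + int k \<le> r + s"
      using sm[OF YZ h(3)] by blast
    \<comment> \<open>As \<open>s\<close> is at most \<open>k\<close>, the intersection inherits a
      demand of at least \<open>p\<close>. Its upper bound, subtracted from the tight equation for
      \<open>Y\<close>, leaves at least \<open>card (Y - Z)\<close> for the sum over
      \<open>Y - Z\<close>, which forces every entry there to be 1.\<close>
    then have "p \<le> r" using sub(3)[OF rs(2)] by simp
    moreover have "sum x (Y \<inter> Z) \<le> real (card (Y \<inter> Z)) - r + 1" using up rs by auto
    moreover have "sum x Y = sum x (Y \<inter> Z) + sum x (Y - Z)"
      using fin[OF YZ(1)] by (metis sum.Int_Diff)
    moreover have "card Y = card (Y \<inter> Z) + card (Y - Z)"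
      using fin[OF YZ(1)] card_Int_Diff by blast
    ultimately have ge: "sum x (Y - Z) \<ge> real (card (Y - Z))"
      using that(1) by (auto simp: U_def)
    have YX: "Y \<subseteq> X" using sub YZ by blast
    have "x e = 1" if "e \<in> Y - Z" for e
    proof (rule ccontr)
      assume "x e \<noteq> 1"
      then have "x e < 1" using x1[of e] YX that by auto
      then have "sum x (Y - Z) < sum (\<lambda>_. 1) (Y - Z)"
        using x1 YX that fin[OF YZ(1)] by (intro sum_strict_mono_ex1) auto
      then show False using ge by simp
    qed
    then have "x e \<in> \<int>" if "e \<in> Y - Z" for e using that by simp
    then show ?thesis by (auto simp: F)
  qed
  show "intersecting L"
    unfolding intersecting_def
  proof (intro ballI impI)
    fix P Q assume "P \<in> L" "Q \<in> L" and ne: "P \<inter> Q \<noteq> {}"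
    obtain Y where Y: "(\<exists>p. U Y p) \<or> W Y" "P = Y \<inter> F" using \<open>P \<in> L\<close> Leq[of P] by blast
    obtain Z where Z: "(\<exists>p. U Z p) \<or> W Z" "Q = Z \<inter> F" using \<open>Q \<in> L\<close> Leq[of Q] by blast
    have YZ: "Y \<inter> Z \<noteq> {}" "Z \<inter> Y \<noteq> {}" using ne Y Z by auto
    have eq: "P \<inter> Q = Y \<inter> Z \<inter> F" "P \<union> Q = (Y \<union> Z) \<inter> F" using Y Z by auto
    consider p q where "U Y p" "U Z q" | "W Y" "W Z" | p where "U Y p" "W Z" | q where "W Y" "U Z q"
      using Y Z by blast
    then show "P \<inter> Q \<in> L \<and> P \<union> Q \<in> L"
    proof cases
      case 1 then show ?thesis using UU YZ eq by metis
    next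
      case 2 then show ?thesis using WW YZ eq by metis
    next
      case 3
      then have "P \<inter> Q = P" "P \<union> Q = Q" using UW[of Y _ Z] YZ Y Z by auto
      then show ?thesis using \<open>P \<in> L\<close> \<open>Q \<in> L\<close> by simp
    next
      case 4
      then have "P \<inter> Q = Q" "P \<union> Q = P" using UW[of Z _ Y] YZ Y Z by auto
      then show ?thesis using \<open>P \<in> L\<close> \<open>Q \<in> L\<close> by simp
    qed
  qed
  show "sum x P \<in> \<int>" if P: "P \<in> L" for P
  proof -
    obtain Y p where Y: "(Y, p) \<in> G" "sum x Y = real (card Y) - p + 1 \<or> sum x Y = 1" "P = Y \<inter> F"
      using P unfolding L by blast
    have "sum x Y \<in> \<int>" using Y(2) by auto
    moreover have "sum x (Y - F) \<in> \<int>" using sub(1)[OF Y(1)] by (intro Ints_sum) (auto simp: F)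
    moreover have "sum x Y = sum x P + sum x (Y - F)"
      using Y(3) fin[OF Y(1)] by (metis sum.Int_Diff)
    ultimately show ?thesis by (metis Ints_diff add_diff_cancel_right')
  qed
qed

text \<open>The vector with all entries \<open>1/k\<close> is a fractional solution; a vertex of the polytope of
  fractional solutions is integral.\<close>

lemma colour_class_exists:
  assumes finX: "finite X" and k: "k > 0"
    and G1: "colourable_demand X k G1" and G2: "colourable_demand X k G2"
  obtains J where "J \<subseteq> X" "\<And>Y. (Y, int k) \<in> G1 \<union> G2 \<Longrightarrow> J \<inter> Y \<noteq> {}"
    "\<And>Y p. (Y, p) \<in> G1 \<union> G2 \<Longrightarrow> int (card (J \<inter> Y)) \<le> int (card Y) - p + 1"
proof -
  let ?G = "G1 \<union> G2"
  have finG: "finite ?G" using G1 G2 by (auto simp: colourable_demand_def)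
  have sub: "Y \<subseteq> X" "p \<le> int (card Y)" "p \<le> int k" if "(Y, p) \<in> ?G" for Y p
    using G1 G2 that by (auto simp: colourable_demand_def)
  \<comment> \<open>In this order: the unit box, the upper bounds for all demands, and the lower
    bound 1 for each set with demand \<open>k\<close>.\<close>
  define Q :: "(real \<times> 'a set \<times> real) set" where
    "Q = (\<lambda>e. (1, {e}, 0)) ` X \<union> (\<lambda>e. (-1, {e}, 1)) ` X
         \<union> (\<lambda>(Y, p). (-1, Y, real (card Y) - p + 1)) ` ?G
         \<union> (\<lambda>(Y, p). (1, Y, -1)) ` {(Y, p). (Y, p) \<in> ?G \<and> p = int k}"
  have finQ: "finite Q" unfolding Q_def using finX finG
    by (auto intro!: finite_imageI intro: finite_subset[OF _ finG])
  have Qbox: "(1, {e}, 0) \<in> Q \<and> (-1, {e}, 1) \<in> Q" if "e \<in> X" for e using that by (auto simp: Q_def)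
  have Qup: "(-1, Y, real (card Y) - p + 1) \<in> Q" if "(Y, p) \<in> ?G" for Y p
    unfolding Q_def using that by force
  have Qlo: "(1, Y, -1) \<in> Q" if "(Y, int k) \<in> ?G" for Y
    unfolding Q_def using that by force
  have Qcases: "(\<exists>e\<in>X. Y = {e} \<and> (s = 1 \<and> c = 0 \<or> s = -1 \<and> c = 1)) \<or>
      (\<exists>p. (Y, p) \<in> ?G \<and> s = -1 \<and> c = real (card Y) - p + 1) \<or>
      ((Y, int k) \<in> ?G \<and> s = 1 \<and> c = -1)" if "(s, Y, c) \<in> Q" for s Y c
    using that unfolding Q_def by auto
  define x0 :: "'a \<Rightarrow> real" where "x0 = (\<lambda>_. 1 / real k)"
  have x0: "s * sum x0 Y + c \<ge> 0" if "(s, Y, c) \<in> Q" for s Y c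
  proof -
    consider "\<exists>e. Y = {e} \<and> (s = 1 \<and> c = 0 \<or> s = -1 \<and> c = 1)"
      | p where "(Y, p) \<in> ?G" "s = -1" "c = real (card Y) - p + 1"
      | "(Y, int k) \<in> ?G" "s = 1" "c = -1"
      using Qcases[OF \<open>(s, Y, c) \<in> Q\<close>] by blast
    then show ?thesis
    proof cases
      case 1 then show ?thesis using k by (auto simp: x0_def)
    next
      case 2
      let ?m = "real (card Y)"
      have "real_of_int p \<le> ?m" "real_of_int p \<le> real k" using sub(2,3)[OF 2(1)] by linarith+
      \<comment> \<open>The worst case is \<open>p = min m k\<close>. For \<open>m \<le> k\<close>
        the right side is 1; for \<open>m > k\<close> the claim amounts to
        \<open>(m - k) * (k - 1) \<ge> 0\<close>.\<close>
      moreover have "?m / real k \<le> ?m - min ?m (real k) + 1"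
      proof (cases "?m \<le> real k")
        case True then show ?thesis using k by simp
      next
        case False
        then have "(?m - real k) * (real k - 1) \<ge> 0" using k by (intro mult_nonneg_nonneg) auto
        then show ?thesis using False k by (simp add: field_simps)
      qed
      ultimately have "?m / real k \<le> ?m - p + 1" by linarith
      then show ?thesis using 2 by (simp add: x0_def)
    next
      case 3
      have "real (card Y) \<ge> real k" using sub(2)[OF 3(1)] by simp
      then show ?thesis using 3 k by (simp add: x0_def field_simps)
    qed
  qed
  obtain x where x: "\<And>s Y c. (s, Y, c) \<in> Q \<Longrightarrow> s * sum x Y + c \<ge> 0"
    and vert: "\<And>d e. (\<And>s Y c. (s, Y, c) \<in> Q \<Longrightarrow> s * sum x Y + c = 0 \<Longrightarrow> sum d Y = 0)
           \<Longrightarrow> e \<in> X \<Longrightarrow> d e = (0::real)"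
    using vertex_exists[OF finQ Qbox x0] by metis
  have xbox: "0 \<le> x e" "x e \<le> 1" if "e \<in> X" for e
    using x[of 1 "{e}" 0] x[of "-1" "{e}" 1] Qbox[OF that] by auto
  have up: "sum x Y \<le> real (card Y) - p + 1" if "(Y, p) \<in> ?G" for Y p
    using x[OF Qup[OF that]] by simp
  have lo: "sum x Y \<ge> 1" if "(Y, int k) \<in> ?G" for Y using x[OF Qlo[OF that]] by simp
  define F where "F = {e\<in>X. x e \<notin> \<int>}"
  have finF: "finite F" using finX by (simp add: F_def)
  define L where "L G = {Y \<inter> F | Y p. (Y, p) \<in> G \<and>
              (sum x Y = real (card Y) - p + 1 \<or> p = int k \<and> sum x Y = 1)}" for G :: "('a set \<times> int) set"
  have L1: "intersecting (L G1)" "\<And>P. P \<in> L G1 \<Longrightarrow> sum x P \<in> \<int>"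
    by (rule intersecting_tight_sets[OF finX G1 xbox(2) up lo F_def L_def]; simp)+
  have L2: "intersecting (L G2)" "\<And>P. P \<in> L G2 \<Longrightarrow> sum x P \<in> \<int>"
    by (rule intersecting_tight_sets[OF finX G2 xbox(2) up lo F_def L_def]; simp)+
  have "F = {}"
  proof (rule ccontr)
    assume "F \<noteq> {}"
    have sF: "P \<subseteq> F" if "P \<in> L G" for P G using that by (auto simp: L_def)
    have fr: "x e \<notin> \<int>" if "e \<in> F" for e using that by (simp add: F_def)
    have "\<exists>d :: 'a \<Rightarrow> real. (\<exists>e\<in>F. d e \<noteq> 0) \<and> (\<forall>P\<in>L G1 \<union> L G2. sum d P = 0)"
      by (rule two_intersecting_families_kernel[OF finF \<open>F \<noteq> {}\<close> sF L1(1) sF L2(1) L1(2) L2(2) fr])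
    then obtain d :: "'a \<Rightarrow> real" where d: "\<exists>e\<in>F. d e \<noteq> 0" "\<And>P. P \<in> L G1 \<union> L G2 \<Longrightarrow> sum d P = 0"
      by blast
    \<comment> \<open>Extended by zero, the direction also respects the tight box constraints,
      because these concern entries with value 0 or 1, which lie outside \<open>F\<close>.\<close>
    let ?d = "\<lambda>e. if e \<in> F then d e else 0"
    have dF: "sum ?d Y = sum d (Y \<inter> F)" if "finite Y" for Y
      using that by (simp add: sum.inter_restrict)
    have "sum ?d Y = 0" if q: "(s, Y, c) \<in> Q" "s * sum x Y + c = 0" for s Y c
    proof -
      have tightL: "Y \<inter> F \<in> L G1 \<union> L G2" "finite Y" if "(Y, p) \<in> ?G"
        "sum x Y = real (card Y) - p + 1 \<or> p = int k \<and> sum x Y = 1" for p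
        using that sub(1)[OF that(1)] finX by (auto simp: L_def intro: finite_subset)
      consider e where "e \<in> X" "Y = {e}" "s = 1 \<and> c = 0 \<or> s = -1 \<and> c = 1"
        | p where "(Y, p) \<in> ?G" "s = -1" "c = real (card Y) - p + 1"
        | "(Y, int k) \<in> ?G" "s = 1" "c = -1"
        using Qcases[OF q(1)] by blast
      then show ?thesis
      proof cases
        case 1
        then have "x e = 0 \<or> x e = 1" using q(2) by auto
        then have "e \<notin> F" by (auto simp: F_def)
        then show ?thesis using 1 by simp
      next
        case 2
        then have "sum x Y = real (card Y) - p + 1" using q(2) by simp
        then have "Y \<inter> F \<in> L G1 \<union> L G2" "finite Y" using tightL[OF 2(1)] by blast+
        then show ?thesis using dF d(2) by simp
      next
        case 3
        then have "sum x Y = 1" using q(2) by simp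
        then have "Y \<inter> F \<in> L G1 \<union> L G2" "finite Y" using tightL[OF 3(1)] by blast+
        then show ?thesis using dF d(2) by simp
      qed
    qed
    then have "?d e = 0" if "e \<in> X" for e using vert that by blast
    then show False using d(1) by (force simp: F_def)
  qed
  then have x01: "x e = 0 \<or> x e = 1" if "e \<in> X" for e
  proof -
    have "x e \<in> \<int>" using \<open>F = {}\<close> that by (auto simp: F_def)
    then obtain n where "x e = of_int n" by (rule Ints_cases)
    then show ?thesis using xbox[OF that] by auto
  qed
  define J where "J = {e\<in>X. x e = 1}"
  have cardJ: "sum x Y = real (card (J \<inter> Y))" if "Y \<subseteq> X" for Y
  proof -
    have "finite Y" using that finX finite_subset by blast
    have "sum x Y = sum (\<lambda>e. if e \<in> J then 1 else 0) Y"
      using x01 that by (intro sum.cong) (auto simp: J_def)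
    also have "\<dots> = real (card (J \<inter> Y))"
      using \<open>finite Y\<close> by (simp add: sum.inter_restrict[symmetric] Int_commute)
    finally show ?thesis .
  qed
  show ?thesis
  proof
    show "J \<subseteq> X" by (auto simp: J_def)
    show "J \<inter> Y \<noteq> {}" if "(Y, int k) \<in> ?G" for Y
      using lo[OF that] cardJ[OF sub(1)[OF that]] by auto
    show "int (card (J \<inter> Y)) \<le> int (card Y) - p + 1" if "(Y, p) \<in> ?G" for Y p
      using up[OF that] cardJ[OF sub(1)[OF that]] by linarith
  qed
qed

text \<open>The indicator of being met by \<open>J\<close> is submodular, so subtracting it
  preserves supermodularity. The new demand is at most \<open>k\<close> by \<open>hit\<close>, and
  at most the number of remaining elements by \<open>few\<close>; if \<open>J\<close> misses
  \<open>Y\<close>, nothing has been taken from \<open>Y\<close>.\<close>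

lemma colourable_demand_step:
  assumes finX: "finite X" and G: "colourable_demand X (Suc k) G"
    and hit: "\<And>Y. (Y, int (Suc k)) \<in> G \<Longrightarrow> J \<inter> Y \<noteq> {}"
    and few: "\<And>Y p. (Y, p) \<in> G \<Longrightarrow> int (card (J \<inter> Y)) \<le> int (card Y) - p + 1"
  shows "colourable_demand (X - J) k ((\<lambda>(Y, p). (Y - J, p - of_bool (J \<inter> Y \<noteq> {}))) ` G)"
    (is "colourable_demand _ _ (?f ` G)")
proof -
  have sub: "Y \<subseteq> X" "p \<le> int (card Y)" "p \<le> int (Suc k)" if "(Y, p) \<in> G" for Y p
    using G that by (auto simp: colourable_demand_def)
  have "intersecting_supermodular (?f ` G)"
    unfolding intersecting_supermodular_def
  proof (intro allI impI)
    fix Y' p' Z' q'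
    assume "(Y', p') \<in> ?f ` G" "(Z', q') \<in> ?f ` G" and ne: "Y' \<inter> Z' \<noteq> {}"
    then obtain Y p Z q where Y: "(Y, p) \<in> G" "Y' = Y - J" "p' = p - of_bool (J \<inter> Y \<noteq> {})"
      and Z: "(Z, q) \<in> G" "Z' = Z - J" "q' = q - of_bool (J \<inter> Z \<noteq> {})" by auto
    have "Y \<inter> Z \<noteq> {}" using ne Y Z by auto
    then obtain r s where rs: "(Y \<inter> Z, r) \<in> G" "(Y \<union> Z, s) \<in> G" "p + q \<le> r + s"
      using G Y(1) Z(1) unfolding colourable_demand_def intersecting_supermodular_def by blast
    let ?r = "r - of_bool (J \<inter> (Y \<inter> Z) \<noteq> {})" and ?s = "s - of_bool (J \<inter> (Y \<union> Z) \<noteq> {})"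
    have "(Y' \<inter> Z', ?r) \<in> ?f ` G" using rs(1) Y Z by (intro image_eqI[of _ _ "(Y \<inter> Z, r)"]) auto
    moreover have "(Y' \<union> Z', ?s) \<in> ?f ` G" using rs(2) Y Z by (intro image_eqI[of _ _ "(Y \<union> Z, s)"]) auto
    moreover have "p' + q' \<le> ?r + ?s" 
    proof -
      have "of_bool (J \<inter> (Y \<inter> Z) \<noteq> {}) + of_bool (J \<inter> (Y \<union> Z) \<noteq> {})
          \<le> of_bool (J \<inter> Y \<noteq> {}) + (of_bool (J \<inter> Z \<noteq> {}) :: int)"
        by (cases "J \<inter> Y = {}"; cases "J \<inter> Z = {}") (auto simp: Int_Un_distrib)
      then show ?thesis using rs(3) Y(3) Z(3) by linarith
    qed
    ultimately show "\<exists>r s. (Y' \<inter> Z', r) \<in> ?f ` G \<and> (Y' \<union> Z', s) \<in> ?f ` G \<and> p' + q' \<le> r + s" by blast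
  qed
  moreover have "Y - J \<subseteq> X - J \<and> p - of_bool (J \<inter> Y \<noteq> {}) \<le> int (card (Y - J)) \<and>
      p - of_bool (J \<inter> Y \<noteq> {}) \<le> int k" if "(Y, p) \<in> G" for Y p
  proof -
    have "finite Y" using sub[OF that] finX finite_subset by blast
    then have "card Y = card (Y \<inter> J) + card (Y - J)" by (rule card_Int_Diff)
    then have c: "int (card Y) = int (card (J \<inter> Y)) + int (card (Y - J))" by (simp add: Int_commute)
    have "p \<noteq> int (Suc k)" if "J \<inter> Y = {}" using hit \<open>(Y, p) \<in> G\<close> that by blast
    then show ?thesis using sub[OF that] few[OF that] c
      by (cases "J \<inter> Y = {}") auto
  qed
  moreover have "finite (?f ` G)" using G by (auto simp: colourable_demand_def)
  ultimately show ?thesis by (auto simp: colourable_demand_def)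
qed

text \<open>Induction on the number of colours. The recursive classes avoid \<open>J\<close>, so
  \<open>J\<close> can become the class with number \<open>k\<close>, and it restores the one unit
  subtracted from the demands of the sets that it meets.\<close>

theorem supermodular_colouring:
  assumes "finite X" "colourable_demand X k G1" "colourable_demand X k G2"
  shows "\<exists>Xs :: nat \<Rightarrow> 'e set. (\<forall>i<k. Xs i \<subseteq> X) \<and> (\<forall>i<k. \<forall>j<k. i \<noteq> j \<longrightarrow> Xs i \<inter> Xs j = {}) \<and>
    (\<forall>(Y, p)\<in>G1 \<union> G2. p \<le> int (card {i. i < k \<and> Xs i \<inter> Y \<noteq> {}}))"
  using assms
proof (induction k arbitrary: X G1 G2)
  case 0
  then show ?case by (auto simp: colourable_demand_def)
next
  case (Suc k)
  obtain J where J: "J \<subseteq> X" "\<And>Y. (Y, int (Suc k)) \<in> G1 \<union> G2 \<Longrightarrow> J \<inter> Y \<noteq> {}"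
    "\<And>Y p. (Y, p) \<in> G1 \<union> G2 \<Longrightarrow> int (card (J \<inter> Y)) \<le> int (card Y) - p + 1"
    using colour_class_exists[OF Suc.prems(1) _ Suc.prems(2,3)] by auto
  let ?f = "\<lambda>(Y, p). (Y - J, p - of_bool (J \<inter> Y \<noteq> {}))"
  have "colourable_demand (X - J) k (?f ` G1)" "colourable_demand (X - J) k (?f ` G2)"
    by (rule colourable_demand_step; use Suc.prems J in auto)+
  from Suc.IH[OF finite_Diff[OF Suc.prems(1)] this] obtain Xs :: "nat \<Rightarrow> 'e set" where Xs: "\<forall>i<k. Xs i \<subseteq> X - J" "\<forall>i<k. \<forall>j<k. i \<noteq> j \<longrightarrow> Xs i \<inter> Xs j = {}"
    "\<forall>(Y, p)\<in>?f ` G1 \<union> ?f ` G2. p \<le> int (card {i. i < k \<and> Xs i \<inter> Y \<noteq> {}})"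
    by (elim exE conjE)
  let ?Xs = "Xs(k := J)"
  have demand: "p \<le> int (card {i. i < Suc k \<and> ?Xs i \<inter> Y \<noteq> {}})" if "(Y, p) \<in> G1 \<union> G2" for Y p
  proof -
    let ?A = "{i. i < k \<and> Xs i \<inter> (Y - J) \<noteq> {}}"
    have "(Y - J, p - of_bool (J \<inter> Y \<noteq> {})) \<in> ?f ` (G1 \<union> G2)"
      using that by (rule rev_image_eqI) simp
    from bspec[OF Xs(3)[folded image_Un] this]
    have le: "p - of_bool (J \<inter> Y \<noteq> {}) \<le> int (card ?A)" by simp
    have eq: "{i. i < Suc k \<and> ?Xs i \<inter> Y \<noteq> {}} = (if J \<inter> Y \<noteq> {} then insert k ?A else ?A)"
      using Xs(1) by (auto simp: less_Suc_eq)
    have "card (insert k ?A) = Suc (card ?A)" by simp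
    then show ?thesis unfolding eq using le by (cases "J \<inter> Y = {}") (simp_all del: card_insert_disjoint)
  qed
  have sub: "\<forall>i<Suc k. ?Xs i \<subseteq> X" using Xs(1) J(1) by (auto simp: less_Suc_eq)
  have disj: "?Xs i \<inter> ?Xs j = {}" if "i < Suc k" "j < Suc k" "i \<noteq> j" for i j
    using Xs(1,2) that by (cases "i = k"; cases "j = k") (auto simp: less_Suc_eq)
  show ?case
  proof (intro exI[of _ ?Xs] conjI sub)
    show "\<forall>i<Suc k. \<forall>j<Suc k. i \<noteq> j \<longrightarrow> ?Xs i \<inter> ?Xs j = {}" using disj by blast
    show "\<forall>(Y, p)\<in>G1 \<union> G2. p \<le> int (card {i. i < Suc k \<and> ?Xs i \<inter> Y \<noteq> {}})"
      using demand by blast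
  qed
qed

subsection \<open>Disjoint branchings\<close>

lemma reach_mono: "reach B tail head u v \<Longrightarrow> B \<subseteq> C \<Longrightarrow> reach C tail head u v"
  unfolding reach_def arc_rel_def by (rule rev_subsetD, assumption, rule rtrancl_mono) blast

lemma reach_refl [simp]: "reach B tail head v v"
  by (simp add: reach_def)

lemma reach_trans: "reach B tail head u v \<Longrightarrow> reach B tail head v w \<Longrightarrow> reach B tail head u w"
  by (auto simp: reach_def)

lemma reach_arc: "e \<in> B \<Longrightarrow> reach B tail head (tail e) (head e)"
  by (auto simp: reach_def arc_rel_def)

lemma card_filter_eq_sum: "finite A \<Longrightarrow> card {e\<in>A. P e} = (\<Sum>e\<in>A. of_bool (P e))"
  by (simp add: Int_def flip: sum.inter_filter)

lemma card_delta_in_submodular: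
  assumes "finite A"
  shows "card (delta_in A tail head (U \<inter> W)) + card (delta_in A tail head (U \<union> W))
    \<le> card (delta_in A tail head U) + card (delta_in A tail head W)"
  unfolding delta_in_def card_filter_eq_sum[OF assms] sum.distrib[symmetric]
  by (intro sum_mono) (auto simp: of_bool_def)

text \<open>Both parts are checked index by index. An index whose root set meets \<open>U\<close>
  and \<open>W\<close> but not their intersection counts nothing on the left and one on the right;
  this strictness is what keeps a root in the intersection when tight sets are uncrossed.\<close>

lemma card_avoiding_supermodular:
  fixes R :: "nat \<Rightarrow> 'v set" and k :: nat
  defines "p \<equiv> \<lambda>U. card {i. i < k \<and> R i \<inter> U = {}}"
  shows "p U + p W \<le> p (U \<inter> W) + p (U \<union> W)"
    and "i < k \<Longrightarrow> R i \<inter> U \<noteq> {} \<Longrightarrow> R i \<inter> W \<noteq> {} \<Longrightarrow> R i \<inter> (U \<inter> W) = {} \<Longrightarrow>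
      p U + p W < p (U \<inter> W) + p (U \<union> W)"
proof -
  have p: "p U = (\<Sum>i<k. of_bool (R i \<inter> U = {}))" for U
    using card_filter_eq_sum[of "{..<k}" "\<lambda>i. R i \<inter> U = {}"] by (simp add: p_def)
  have le: "of_bool (R i \<inter> U = {}) + of_bool (R i \<inter> W = {})
      \<le> (of_bool (R i \<inter> (U \<inter> W) = {}) + of_bool (R i \<inter> (U \<union> W) = {}) :: nat)" for i
    by (auto simp: of_bool_def)
  show "p U + p W \<le> p (U \<inter> W) + p (U \<union> W)"
    unfolding p sum.distrib[symmetric] by (intro sum_mono le)
  show "p U + p W < p (U \<inter> W) + p (U \<union> W)"
    if "i < k" "R i \<inter> U \<noteq> {}" "R i \<inter> W \<noteq> {}" "R i \<inter> (U \<inter> W) = {}"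
    unfolding p sum.distrib[symmetric]
    using that le by (intro sum_strict_mono_ex1) (auto intro!: bexI[of _ i])
qed

text \<open>Edmonds' disjoint branchings theorem with prescribed root sets, by Lovasz's argument: some arc
  leaving an incomplete root set can be moved into its branching without violating the cut
  condition.\<close>

theorem disjoint_branchings:
  fixes R :: "nat \<Rightarrow> 'v set" and A :: "'e set"
  assumes "finite T" "finite A"
    and "\<And>e. e \<in> A \<Longrightarrow> tail e \<in> T \<and> head e \<in> T"
    and "\<And>i. i < k \<Longrightarrow> R i \<subseteq> T"
    and "\<And>U. U \<noteq> {} \<Longrightarrow> U \<subseteq> T \<Longrightarrow>
      card {i. i < k \<and> R i \<inter> U = {}} \<le> card (delta_in A tail head U)"
  shows "\<exists>B :: nat \<Rightarrow> 'e set. (\<forall>i<k. B i \<subseteq> A \<and> (\<forall>v\<in>T. \<exists>r\<in>R i. reach (B i) tail head r v) \<and>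
      (\<forall>v\<in>T. indeg (B i) head v \<le> of_bool (v \<notin> R i))) \<and>
    (\<forall>i<k. \<forall>j<k. i \<noteq> j \<longrightarrow> B i \<inter> B j = {})"
  using assms
proof (induction "\<Sum>i<k. card (T - R i)" arbitrary: A R rule: less_induct)
  case less
  note finT = less.prems(1) and finA = less.prems(2) and arcs = less.prems(3)
    and RT = less.prems(4) and cut = less.prems(5)
  show ?case
  proof (cases "\<forall>i<k. R i = T")
    case True
    then show ?thesis by (intro exI[of _ "\<lambda>_. {}"]) (auto simp: indeg_def intro: reach_refl)
  next
    case False
    then obtain i0 where i0: "i0 < k" "R i0 \<noteq> T" by blast
    define p where "p U = card {i. i < k \<and> R i \<inter> U = {}}" for U
    define d where "d U = card (delta_in A tail head U)" for U
    have pd: "p U \<le> d U" if "U \<noteq> {}" "U \<subseteq> T" for U using cut[OF that] by (simp add: p_def d_def)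
    have Tne: "T \<noteq> {}" using RT[OF i0(1)] i0(2) by auto
    have "d T = 0" using arcs by (auto simp: d_def delta_in_def card_eq_0_iff)
    then have pT: "p T = 0" using pd[of T] Tne by simp
    then have Rne: "R i \<inter> T \<noteq> {}" if "i < k" for i using that by (auto simp: p_def)
    \<comment> \<open>Critical sets are the obstructions: at such a set no entering arc can be
      spared, although the root set \<open>R i0\<close> meets it without covering it. The whole of
      \<open>T\<close> is critical, so a smallest critical set exists.\<close>
    define crit where "crit U \<longleftrightarrow> U \<subseteq> T \<and> U \<inter> R i0 \<noteq> {} \<and> U - R i0 \<noteq> {} \<and> p U = d U" for U
    have "crit T" using RT[OF i0(1)] i0 Rne pT \<open>d T = 0\<close> by (auto simp: crit_def)
    then obtain U where U: "crit U" "\<And>W. crit W \<Longrightarrow> card U \<le> card W"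
      using ex_has_least_nat[of crit T card] by blast
    have finU: "finite U" using U(1) finT finite_subset by (auto simp: crit_def)
    \<comment> \<open>The root set \<open>R i0\<close> avoids \<open>U - R i0\<close> but not
      \<open>U\<close>, so the cut condition demands more arcs into the smaller set. Hence some arc
      enters it from \<open>U \<inter> R i0\<close>.\<close>
    have "d U < d (U - R i0)"
    proof -
      have "{i. i < k \<and> R i \<inter> U = {}} \<subset> {i. i < k \<and> R i \<inter> (U - R i0) = {}}"
        using i0(1) U(1) by (auto simp: crit_def)
      then have "p U < p (U - R i0)" unfolding p_def by (intro psubset_card_mono) auto
      also have "\<dots> \<le> d (U - R i0)" using U(1) by (intro pd) (auto simp: crit_def)
      finally show ?thesis using U(1) by (simp add: crit_def)
    qed
    moreover have "finite (delta_in A tail head U)" using finA by (simp add: delta_in_def)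
    ultimately have "\<not> delta_in A tail head (U - R i0) \<subseteq> delta_in A tail head U"
      unfolding d_def using card_mono leD by metis
    then obtain e where e: "e \<in> A" "tail e \<in> U" "tail e \<in> R i0" "head e \<in> U" "head e \<notin> R i0"
      by (auto simp: delta_in_def)
    \<comment> \<open>If \<open>W\<close> were tight, uncrossing it with \<open>U\<close> would make
      \<open>U \<inter> W\<close> critical; it still contains \<open>head e\<close>, which is
      outside \<open>R i0\<close>, but it has lost \<open>tail e\<close>, against the minimality of
      \<open>U\<close>.\<close>
    have safe: "p W < d W" if W: "W \<subseteq> T" "W \<inter> R i0 \<noteq> {}" "head e \<in> W" "tail e \<notin> W" for W
    proof (rule ccontr)
      assume "\<not> p W < d W"
      moreover have "p W \<le> d W" using W by (intro pd) auto
      ultimately have tW: "p W = d W" by simp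
      have ne: "U \<inter> W \<noteq> {}" "U \<inter> W \<subseteq> T" "U \<union> W \<noteq> {}" "U \<union> W \<subseteq> T"
        using e W U(1) by (auto simp: crit_def)
      have dd: "d (U \<inter> W) + d (U \<union> W) \<le> d U + d W"
        unfolding d_def by (rule card_delta_in_submodular[OF finA])
      have pp: "p U + p W \<le> p (U \<inter> W) + p (U \<union> W)"
        unfolding p_def by (rule card_avoiding_supermodular)
      have "R i0 \<inter> (U \<inter> W) \<noteq> {}"
      proof
        assume "R i0 \<inter> (U \<inter> W) = {}"
        then have "p U + p W < p (U \<inter> W) + p (U \<union> W)"
          unfolding p_def using i0(1) U(1) W
          by (intro card_avoiding_supermodular(2)[of i0]) (auto simp: crit_def)
        then show False using dd pd[OF ne(1,2)] pd[OF ne(3,4)] U(1) tW by (simp add: crit_def)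
      qed
      moreover have "p (U \<inter> W) = d (U \<inter> W)"
        using dd pp pd[OF ne(1,2)] pd[OF ne(3,4)] U(1) tW by (simp add: crit_def)
      ultimately have "crit (U \<inter> W)" using ne e W by (auto simp: crit_def)
      then have "card U \<le> card (U \<inter> W)" by (rule U(2))
      moreover have "U \<inter> W \<subset> U" using e W by auto
      then have "card (U \<inter> W) < card U" using finU by (rule psubset_card_mono[rotated])
      ultimately show False by simp
    qed
    let ?A = "A - {e}" and ?R = "R(i0 := insert (head e) (R i0))"
    have headT: "head e \<in> T" using arcs e by blast
    have "\<exists>B :: nat \<Rightarrow> 'e set. (\<forall>i<k. B i \<subseteq> ?A \<and> (\<forall>v\<in>T. \<exists>r\<in>?R i. reach (B i) tail head r v) \<and>
      (\<forall>v\<in>T. indeg (B i) head v \<le> of_bool (v \<notin> ?R i))) \<and>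
      (\<forall>i<k. \<forall>j<k. i \<noteq> j \<longrightarrow> B i \<inter> B j = {})"
    proof (rule less.hyps)
      show "(\<Sum>i<k. card (T - ?R i)) < (\<Sum>i<k. card (T - R i))"
      proof (rule sum_strict_mono_ex1)
        show "\<forall>i\<in>{..<k}. card (T - ?R i) \<le> card (T - R i)"
          using finT by (auto intro!: card_mono)
        have "card (T - ?R i0) < card (T - R i0)"
          using finT headT e by (intro psubset_card_mono) auto
        then show "\<exists>i\<in>{..<k}. card (T - ?R i) < card (T - R i)" using i0 by blast
      qed simp
      show "?R i \<subseteq> T" if "i < k" for i using RT[OF that] headT by auto
      show "card {i. i < k \<and> ?R i \<inter> W = {}} \<le> card (delta_in ?A tail head W)"
        if W: "W \<noteq> {}" "W \<subseteq> T" for W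
      proof -
        have sub: "{i. i < k \<and> ?R i \<inter> W = {}} \<subseteq> {i. i < k \<and> R i \<inter> W = {}}" by auto
        then have le: "card {i. i < k \<and> ?R i \<inter> W = {}} \<le> p W"
          unfolding p_def by (intro card_mono) auto
        show ?thesis
        \<comment> \<open>Deleting \<open>e\<close> costs only sets that \<open>e\<close> enters.
          Such a set either meets \<open>R i0\<close> and has an arc to spare, or it gains the root
          \<open>head e\<close> and its demand drops as well.\<close>
        proof (cases "tail e \<notin> W \<and> head e \<in> W")
          case False
          then have "delta_in ?A tail head W = delta_in A tail head W" by (auto simp: delta_in_def)
          then show ?thesis using le pd[OF W] by (simp add: d_def)
        next
          case True
          then have "delta_in ?A tail head W = delta_in A tail head W - {e}" "e \<in> delta_in A tail head W"
            using e by (auto simp: delta_in_def)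
          then have dW: "card (delta_in ?A tail head W) = d W - 1" by (simp add: d_def)
          show ?thesis
          proof (cases "W \<inter> R i0 = {}")
            case True
            then have "{i. i < k \<and> ?R i \<inter> W = {}} \<subset> {i. i < k \<and> R i \<inter> W = {}}"
              using sub i0(1) \<open>tail e \<notin> W \<and> head e \<in> W\<close> by (auto simp: Int_commute)
            then have "card {i. i < k \<and> ?R i \<inter> W = {}} < p W"
              unfolding p_def by (intro psubset_card_mono) auto
            then show ?thesis using dW pd[OF W] by linarith
          next
            case False
            then have "p W < d W" using safe W True by blast
            then show ?thesis using dW le by linarith
          qed
        qed
      qed
    qed (use finT finA arcs in auto)
    then obtain B :: "nat \<Rightarrow> 'e set" where BB:
      "\<forall>i<k. B i \<subseteq> ?A \<and> (\<forall>v\<in>T. \<exists>r\<in>?R i. reach (B i) tail head r v) \<and>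
        (\<forall>v\<in>T. indeg (B i) head v \<le> of_bool (v \<notin> ?R i))"
      "\<forall>i<k. \<forall>j<k. i \<noteq> j \<longrightarrow> B i \<inter> B j = {}" by (elim exE conjE)
    have B: "\<And>i. i < k \<Longrightarrow> B i \<subseteq> ?A" "\<And>i v. i < k \<Longrightarrow> v \<in> T \<Longrightarrow> \<exists>r\<in>?R i. reach (B i) tail head r v"
        "\<And>i v. i < k \<Longrightarrow> v \<in> T \<Longrightarrow> indeg (B i) head v \<le> of_bool (v \<notin> ?R i)"
        "\<And>i j. i < k \<Longrightarrow> j < k \<Longrightarrow> i \<noteq> j \<Longrightarrow> B i \<inter> B j = {}" using BB by blast+
    \<comment> \<open>The arc \<open>e\<close> links the artificial root \<open>head e\<close> back
      to the genuine root \<open>tail e\<close>.\<close>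
    let ?B = "B(i0 := insert e (B i0))"
    have "?B i \<subseteq> A" if "i < k" for i using B(1)[OF that] e(1) by auto
    moreover have "\<exists>r\<in>R i. reach (?B i) tail head r v" if iv: "i < k" "v \<in> T" for i v
    proof (cases "i = i0")
      case False
      then show ?thesis using B(2)[OF that] by simp
    next
      case True
      obtain r where r: "r \<in> insert (head e) (R i0)" "reach (B i0) tail head r v"
        using B(2)[OF iv] True by auto
      have r': "reach (insert e (B i0)) tail head r v" using r(2) by (rule reach_mono) blast
      show ?thesis
      proof (cases "r = head e")
        case True
        have "reach (insert e (B i0)) tail head (tail e) (head e)" by (rule reach_arc) simp
        then have "reach (insert e (B i0)) tail head (tail e) v" using r' True reach_trans by metis
        then show ?thesis using e(3) \<open>i = i0\<close> by auto
      next
        case False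
        then show ?thesis using r r' \<open>i = i0\<close> by auto
      qed
    qed
    \<comment> \<open>As a root of the reduced instance, \<open>head e\<close> has indegree 0 in
      \<open>B i0\<close>, so restoring \<open>e\<close> raises it only to 1.\<close>
    moreover have "indeg (?B i) head v \<le> of_bool (v \<notin> R i)" if "i < k" "v \<in> T" for i v
    proof (cases "i = i0 \<and> v = head e")
      case True
      then have "indeg (B i0) head v = 0" using B(3)[OF that] by simp
      moreover have "finite (B i0)" using B(1)[OF i0(1)] finA by (meson finite_Diff finite_subset)
      ultimately have "{f\<in>B i0. head f = v} = {}" by (simp add: indeg_def)
      then have "{f\<in>insert e (B i0). head f = v} = {e}" using True by auto
      then show ?thesis using True e(5) by (simp add: indeg_def)
    next
      case False
      then have "{f\<in>?B i. head f = v} = {f\<in>B i. head f = v}" by auto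
      then show ?thesis using B(3)[OF that] False by (auto simp: indeg_def split: if_splits)
    qed
    moreover have "?B i \<inter> ?B j = {}" if "i < k" "j < k" "i \<noteq> j" for i j
      using B(4)[OF that] B(1)[OF that(1)] B(1)[OF that(2)] that(3) by auto
    ultimately show ?thesis by (intro exI[of _ ?B]) simp
  qed
qed

lemma disjoint_subsets_of_card:
  fixes n :: "nat \<Rightarrow> nat"
  assumes "finite L" "(\<Sum>i<k. n i) \<le> card L"
  shows "\<exists>E. (\<forall>i<k. E i \<subseteq> L \<and> card (E i) = n i) \<and> (\<forall>i<k. \<forall>j<k. i \<noteq> j \<longrightarrow> E i \<inter> E j = {})"
  using assms
proof (induction k arbitrary: L)
  case 0
  then show ?case by simp
next
  case (Suc k)
  then have "n k \<le> card L" by simp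
  then obtain M where M: "M \<subseteq> L" "card M = n k" "finite M" by (rule obtain_subset_with_card_n)
  have "(\<Sum>i<k. n i) \<le> card (L - M)" using Suc.prems M by (simp add: card_Diff_subset)
  then obtain E where E: "\<forall>i<k. E i \<subseteq> L - M \<and> card (E i) = n i"
    "\<forall>i<k. \<forall>j<k. i \<noteq> j \<longrightarrow> E i \<inter> E j = {}"
    using Suc.IH[of "L - M"] Suc.prems by blast
  have "(E(k := M)) i \<inter> (E(k := M)) j = {}" if "i < Suc k" "j < Suc k" "i \<noteq> j" for i j
    using E that by (cases "i = k"; cases "j = k") (auto simp: less_Suc_eq)
  moreover have "(E(k := M)) i \<subseteq> L \<and> card ((E(k := M)) i) = n i" if "i < Suc k" for i
    using E(1) M that by (auto simp: less_Suc_eq)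
  ultimately show ?case by blast
qed

text \<open>The branchings use at most one arc into each vertex, and only where no root arc of the same
  colour enters; as \<open>b \<ge> 1\<close>, the unused arcs suffice to raise all indegrees to \<open>b\<close>.\<close>

lemma disjoint_b_branchings:
  fixes Xs :: "nat \<Rightarrow> 'e set" and A :: "'e set"
  assumes finT: "finite T" and finA: "finite A" and arcs: "\<And>e. e \<in> A \<Longrightarrow> tail e \<in> T \<and> head e \<in> T"
    and Xs: "\<And>i. i < k \<Longrightarrow> finite (Xs i)" "\<And>i e. i < k \<Longrightarrow> e \<in> Xs i \<Longrightarrow> head e \<in> T"
    and cut: "\<And>U. U \<noteq> {} \<Longrightarrow> U \<subseteq> T \<Longrightarrow>
      k \<le> card {i. i < k \<and> head ` Xs i \<inter> U \<noteq> {}} + card (delta_in A tail head U)"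
    and deg: "\<And>v. v \<in> T \<Longrightarrow> k * b v \<le> (\<Sum>i<k. min (b v) (indeg (Xs i) head v)) + indeg A head v"
    and b: "\<And>v. v \<in> T \<Longrightarrow> b v > 0"
  shows "\<exists>B :: nat \<Rightarrow> 'e set. (\<forall>i<k. B i \<subseteq> A \<and> (\<forall>v\<in>T. \<exists>e\<in>Xs i. reach (B i) tail head (head e) v) \<and>
      (\<forall>v\<in>T. b v \<le> indeg (Xs i) head v + indeg (B i) head v)) \<and>
    (\<forall>i<k. \<forall>j<k. i \<noteq> j \<longrightarrow> B i \<inter> B j = {})"
proof -
  have "\<exists>B :: nat \<Rightarrow> 'e set. (\<forall>i<k. B i \<subseteq> A \<and> (\<forall>v\<in>T. \<exists>r\<in>head ` Xs i. reach (B i) tail head r v) \<and>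
      (\<forall>v\<in>T. indeg (B i) head v \<le> of_bool (v \<notin> head ` Xs i))) \<and>
    (\<forall>i<k. \<forall>j<k. i \<noteq> j \<longrightarrow> B i \<inter> B j = {})"
  proof (rule disjoint_branchings[OF finT finA arcs])
    show "head ` Xs i \<subseteq> T" if "i < k" for i using Xs(2)[OF that] by auto
    fix U assume U: "U \<noteq> {}" "U \<subseteq> T"
    let ?N = "{i. i < k \<and> head ` Xs i \<inter> U = {}}" and ?M = "{i. i < k \<and> head ` Xs i \<inter> U \<noteq> {}}"
    have "card (?N \<union> ?M) = card ?N + card ?M" by (intro card_Un_disjoint) auto
    moreover have "?N \<union> ?M = {..<k}" by auto
    ultimately have "card ?N + card ?M = k" by simp
    then show "card ?N \<le> card (delta_in A tail head U)" using cut[OF U] by linarith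
  qed
  then obtain B0 :: "nat \<Rightarrow> 'e set" where BB:
    "\<forall>i<k. B0 i \<subseteq> A \<and> (\<forall>v\<in>T. \<exists>r\<in>head ` Xs i. reach (B0 i) tail head r v) \<and>
      (\<forall>v\<in>T. indeg (B0 i) head v \<le> of_bool (v \<notin> head ` Xs i))"
    "\<forall>i<k. \<forall>j<k. i \<noteq> j \<longrightarrow> B0 i \<inter> B0 j = {}" by (elim exE conjE)
  have B0: "\<And>i. i < k \<Longrightarrow> B0 i \<subseteq> A"
      "\<And>i v. i < k \<Longrightarrow> v \<in> T \<Longrightarrow> \<exists>r\<in>head ` Xs i. reach (B0 i) tail head r v"
      "\<And>i v. i < k \<Longrightarrow> v \<in> T \<Longrightarrow> indeg (B0 i) head v \<le> of_bool (v \<notin> head ` Xs i)"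
      "\<And>i j. i < k \<Longrightarrow> j < k \<Longrightarrow> i \<noteq> j \<Longrightarrow> B0 i \<inter> B0 j = {}" using BB by blast+
  have finB0: "finite (B0 i)" if "i < k" for i using B0(1)[OF that] finA finite_subset by blast
  define need where "need v i = b v - (indeg (Xs i) head v + indeg (B0 i) head v)" for v i
  define L where "L v = {e\<in>A. head e = v} - (\<Union>i<k. {e\<in>B0 i. head e = v})" for v
  have finL: "finite (L v)" for v using finA by (simp add: L_def)
  have enough: "(\<Sum>i<k. need v i) \<le> card (L v)" if v: "v \<in> T" for v
  proof -
    \<comment> \<open>The truncated subtraction in \<open>need\<close> never hides a wasted
      branching arc: if a root arc enters \<open>v\<close>, the branching does not; otherwise the
      branching contributes at most one, which \<open>b v \<ge> 1\<close> can absorb.\<close>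
    have "need v i + indeg (B0 i) head v + min (b v) (indeg (Xs i) head v) = b v" if i: "i < k" for i
    proof (cases "v \<in> head ` Xs i")
      case True
      then have "indeg (B0 i) head v = 0" using B0(3)[OF i v] by simp
      then show ?thesis by (simp add: need_def)
    next
      case False
      then have "{e\<in>Xs i. head e = v} = {}" by auto
      then have "indeg (Xs i) head v = 0" by (simp only: indeg_def card.empty)
      moreover have "indeg (B0 i) head v \<le> 1" using B0(3)[OF i v] False by simp
      ultimately show ?thesis using b[OF v] by (simp add: need_def)
    qed
    then have "(\<Sum>i<k. need v i + indeg (B0 i) head v + min (b v) (indeg (Xs i) head v)) = k * b v"
      by simp
    then have "(\<Sum>i<k. need v i) + (\<Sum>i<k. indeg (B0 i) head v) \<le> indeg A head v"
      using deg[OF v] by (simp add: sum.distrib)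
    moreover have "card (\<Union>i<k. {e\<in>B0 i. head e = v}) = (\<Sum>i<k. indeg (B0 i) head v)"
      unfolding indeg_def
    proof (rule card_UN_disjoint)
      show "\<forall>i\<in>{..<k}. \<forall>j\<in>{..<k}. i \<noteq> j \<longrightarrow> {e\<in>B0 i. head e = v} \<inter> {e\<in>B0 j. head e = v} = {}"
        using B0(4) by blast
    qed (use finB0 in simp_all)
    moreover have "card (L v) = card {e\<in>A. head e = v} - card (\<Union>i<k. {e\<in>B0 i. head e = v})"
      unfolding L_def
    proof (rule card_Diff_subset)
      show "(\<Union>i<k. {e\<in>B0 i. head e = v}) \<subseteq> {e\<in>A. head e = v}" using B0(1) by blast
    qed (use finB0 in simp)
    ultimately show ?thesis by (simp add: indeg_def)
  qed
  have "\<forall>v\<in>T. \<exists>E. (\<forall>i<k. E i \<subseteq> L v \<and> card (E i) = need v i) \<and>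
      (\<forall>i<k. \<forall>j<k. i \<noteq> j \<longrightarrow> E i \<inter> E j = {})"
    using disjoint_subsets_of_card[OF finL enough] by blast
  from bchoice[OF this] obtain E where EE:
    "\<forall>v\<in>T. (\<forall>i<k. E v i \<subseteq> L v \<and> card (E v i) = need v i) \<and>
      (\<forall>i<k. \<forall>j<k. i \<noteq> j \<longrightarrow> E v i \<inter> E v j = {})" by (elim exE)
  have E: "\<And>v i. v \<in> T \<Longrightarrow> i < k \<Longrightarrow> E v i \<subseteq> L v"
      "\<And>v i. v \<in> T \<Longrightarrow> i < k \<Longrightarrow> card (E v i) = need v i"
      "\<And>v i j. v \<in> T \<Longrightarrow> i < k \<Longrightarrow> j < k \<Longrightarrow> i \<noteq> j \<Longrightarrow> E v i \<inter> E v j = {}"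
    using EE by blast+
  define B where "B i = B0 i \<union> (\<Union>v\<in>T. E v i)" for i
  have EL: "e \<in> A \<and> head e = v \<and> (\<forall>j<k. e \<notin> B0 j)" if "e \<in> E v i" "v \<in> T" "i < k" for e v i
    using E(1)[OF that(2,3)] that(1) by (auto simp: L_def)
  have "B i \<subseteq> A" if "i < k" for i using B0(1)[OF that] EL that by (auto simp: B_def)
  moreover have "\<exists>e\<in>Xs i. reach (B i) tail head (head e) v" if "i < k" "v \<in> T" for i v
    using B0(2)[OF that] reach_mono[of "B0 i" tail head _ v "B i"] by (auto simp: B_def)
  moreover have "b v \<le> indeg (Xs i) head v + indeg (B i) head v" if i: "i < k" and v: "v \<in> T" for i v
  proof -
    have "finite (E v i)" using E(1)[OF v i] finL finite_subset by blast
    have "indeg (B0 i) head v + need v i = card ({e\<in>B0 i. head e = v} \<union> E v i)"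
      unfolding indeg_def E(2)[OF v i, symmetric] using finB0[OF i] \<open>finite (E v i)\<close> EL[OF _ v i] i
      by (intro card_Un_disjoint[symmetric]) auto
    also have "\<dots> \<le> indeg (B i) head v"
      unfolding indeg_def
    proof (rule card_mono)
      show "finite {e\<in>B i. head e = v}"
        using \<open>i < k \<Longrightarrow> B i \<subseteq> A\<close> i finA by (metis (mono_tags, lifting) finite_subset mem_Collect_eq subset_iff)
    qed (use EL[OF _ v i] v in \<open>auto simp: B_def\<close>)
    finally show ?thesis by (simp add: need_def)
  qed
  moreover have "B i \<inter> B j = {}" if ij: "i < k" "j < k" "i \<noteq> j" for i j
  proof -
    have "False" if h: "e \<in> B i" "e \<in> B j" for e
    proof -
      consider "e \<in> B0 i" "e \<in> B0 j" | v where "v \<in> T" "e \<in> B0 i" "e \<in> E v j"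
        | v where "v \<in> T" "e \<in> E v i" "e \<in> B0 j"
        | v w where "v \<in> T" "w \<in> T" "e \<in> E v i" "e \<in> E w j"
        using h by (auto simp: B_def)
      then show False
      proof cases
        case 1 then show ?thesis using B0(4)[OF ij] by blast
      next
        case 2 then show ?thesis using EL ij by blast
      next
        case 3 then show ?thesis using EL ij by blast
      next
        case 4
        then have "v = w" using EL ij by metis
        then show ?thesis using 4 E(3)[OF 4(1) ij] by blast
      qed
    qed
    then show ?thesis by blast
  qed
  ultimately show ?thesis by (intro exI[of _ B]) simp
qed

subsection \<open>Packing bibranchings\<close>

text \<open>Fill \<open>n\<close> boxes of capacity \<open>k\<close> in turn with \<open>m\<close>
  objects: box \<open>j\<close> receives what the \<open>j * k\<close> earlier places have left, and
  truncated subtraction leaves late boxes empty.\<close>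

lemma sum_min_blocks: "(\<Sum>j<n. min k (m - j * k)) = min m (n * k)" for k m n :: nat
  by (induction n) auto

text \<open>Blocks of at most \<open>k\<close> arcs at each vertex \<open>v\<close>, each of which must be rainbow, force every
  colour to appear \<open>b v\<close> times at \<open>v\<close>, up to the total number of available arcs.\<close>

lemma side_demand:
  fixes X A :: "'e set" and tail head :: "'e \<Rightarrow> 'v"
  assumes finT: "finite T" and finX: "finite X" and finA: "finite A"
    and arcs: "\<And>e. e \<in> A \<Longrightarrow> tail e \<in> T \<and> head e \<in> T" and X: "\<And>e. e \<in> X \<Longrightarrow> head e \<in> T"
    and cut: "\<And>U. U \<noteq> {} \<Longrightarrow> U \<subseteq> T \<Longrightarrow> k \<le> card {e\<in>X. head e \<in> U} + card (delta_in A tail head U)"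
    and deg: "\<And>v. v \<in> T \<Longrightarrow> k * b v \<le> indeg X head v + indeg A head v"
    and b: "\<And>v. v \<in> T \<Longrightarrow> b v > 0"
  obtains G where "colourable_demand X k G"
    and "\<And>Xs :: nat \<Rightarrow> 'e set. \<forall>i<k. Xs i \<subseteq> X \<Longrightarrow> \<forall>i<k. \<forall>j<k. i \<noteq> j \<longrightarrow> Xs i \<inter> Xs j = {} \<Longrightarrow>
      \<forall>(Y, p)\<in>G. p \<le> int (card {i. i < k \<and> Xs i \<inter> Y \<noteq> {}}) \<Longrightarrow>
      \<exists>B :: nat \<Rightarrow> 'e set. (\<forall>i<k. B i \<subseteq> A \<and> (\<forall>v\<in>T. \<exists>e\<in>Xs i. reach (B i) tail head (head e) v) \<and>
        (\<forall>v\<in>T. b v \<le> indeg (Xs i) head v + indeg (B i) head v)) \<and>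
      (\<forall>i<k. \<forall>j<k. i \<noteq> j \<longrightarrow> B i \<inter> B j = {})"
proof -
  have "\<forall>v. \<exists>P. (\<forall>j<b v. P j \<subseteq> {e\<in>X. head e = v} \<and> card (P j) = min k (indeg X head v - j * k)) \<and>
      (\<forall>i<b v. \<forall>j<b v. i \<noteq> j \<longrightarrow> P i \<inter> P j = {})"
    by (intro allI disjoint_subsets_of_card) (use finX in \<open>simp_all add: sum_min_blocks indeg_def\<close>)
  from choice[OF this]
  obtain P where PP: "\<forall>v. (\<forall>j<b v. P v j \<subseteq> {e\<in>X. head e = v} \<and>
        card (P v j) = min k (indeg X head v - j * k)) \<and>
      (\<forall>i<b v. \<forall>j<b v. i \<noteq> j \<longrightarrow> P v i \<inter> P v j = {})" by (elim exE)
  have P: "\<And>v j. j < b v \<Longrightarrow> P v j \<subseteq> {e\<in>X. head e = v}"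
      "\<And>v j. j < b v \<Longrightarrow> card (P v j) = min k (indeg X head v - j * k)"
      "\<And>v i j. i < b v \<Longrightarrow> j < b v \<Longrightarrow> i \<noteq> j \<Longrightarrow> P v i \<inter> P v j = {}" using PP by blast+
  define \<delta> where "\<delta> U = {e\<in>X. head e \<in> U}" for U
  \<comment> \<open>Demands are integers because a cut with more than \<open>k\<close> arcs inside
    \<open>A\<close> has a negative one. In \<open>G2\<close> every block demands as many colours as
    it has elements, so its arcs must all receive different colours.\<close>
  define G1 where "G1 = (\<lambda>U. (\<delta> U, int k - int (card (delta_in A tail head U)))) ` (Pow T - {{}})"
  define G2 where "G2 = (\<lambda>(v, j). (P v j, int (card (P v j)))) ` (SIGMA v:T. {..<b v})"
  have G1I: "(\<delta> U, int k - int (card (delta_in A tail head U))) \<in> G1" if "U \<noteq> {}" "U \<subseteq> T" for U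
    using that unfolding G1_def by blast
  have G1E: "\<exists>U. U \<noteq> {} \<and> U \<subseteq> T \<and> Y = \<delta> U \<and> p = int k - int (card (delta_in A tail head U))"
    if "(Y, p) \<in> G1" for Y p using that unfolding G1_def by blast
  have G2I: "(P v j, int (card (P v j))) \<in> G2" if "v \<in> T" "j < b v" for v j
    using that unfolding G2_def by force
  have G2E: "\<exists>v j. v \<in> T \<and> j < b v \<and> Y = P v j \<and> p = int (card (P v j))"
    if "(Y, p) \<in> G2" for Y p using that unfolding G2_def by auto
  have sm11: "\<exists>r s. (Y \<inter> Z, r) \<in> G1 \<and> (Y \<union> Z, s) \<in> G1 \<and> p + q \<le> r + s"
    if h: "(Y, p) \<in> G1" "(Z, q) \<in> G1" "Y \<inter> Z \<noteq> {}" for Y p Z q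
  proof -
    obtain U where U: "U \<noteq> {}" "U \<subseteq> T" "Y = \<delta> U" "p = int k - int (card (delta_in A tail head U))"
      using G1E[OF h(1)] by blast
    obtain W where W: "W \<noteq> {}" "W \<subseteq> T" "Z = \<delta> W" "q = int k - int (card (delta_in A tail head W))"
      using G1E[OF h(2)] by blast
    have eq: "Y \<inter> Z = \<delta> (U \<inter> W)" "Y \<union> Z = \<delta> (U \<union> W)" using U W by (auto simp: \<delta>_def)
    then have "U \<inter> W \<noteq> {}" using h(3) by (auto simp: \<delta>_def)
    then have "(Y \<inter> Z, int k - int (card (delta_in A tail head (U \<inter> W)))) \<in> G1"
      "(Y \<union> Z, int k - int (card (delta_in A tail head (U \<union> W)))) \<in> G1"
      unfolding eq using U W by (auto intro!: G1I)
    moreover have "p + q \<le> (int k - int (card (delta_in A tail head (U \<inter> W))))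
        + (int k - int (card (delta_in A tail head (U \<union> W))))"
      using card_delta_in_submodular[OF finA, of tail head U W] U W by linarith
    ultimately show ?thesis by blast
  qed
  \<comment> \<open>All arcs of a block share one head, so a cut set that meets the block contains
    it. Together with the disjointness of the blocks this makes every mixed pair of demands uncross
    to itself.\<close>
  have nested12: "Z \<subseteq> Y" if h: "(Y, p) \<in> G1" "(Z, q) \<in> G2" "Y \<inter> Z \<noteq> {}" for Y p Z q
  proof -
    obtain U where U: "Y = \<delta> U" using G1E[OF h(1)] by blast
    obtain v j where v: "j < b v" "Z = P v j" using G2E[OF h(2)] by blast
    then have Z: "Z \<subseteq> {e\<in>X. head e = v}" using P(1) by blast
    then have "v \<in> U" using h(3) U by (auto simp: \<delta>_def)
    then show ?thesis using Z U by (auto simp: \<delta>_def)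
  qed
  have same22: "Y = Z \<and> p = q" if h: "(Y, p) \<in> G2" "(Z, q) \<in> G2" "Y \<inter> Z \<noteq> {}" for Y p Z q
  proof -
    obtain v i where v: "i < b v" "Y = P v i" "p = int (card (P v i))" using G2E[OF h(1)] by blast
    obtain w j where w: "j < b w" "Z = P w j" "q = int (card (P w j))" using G2E[OF h(2)] by blast
    have "v = w" using P(1)[OF v(1)] P(1)[OF w(1)] v(2) w(2) h(3) by blast
    moreover have "i = j" using P(3)[of i v j] v w h(3) \<open>v = w\<close> by blast
    ultimately show ?thesis using v w by simp
  qed
  have "intersecting_supermodular (G1 \<union> G2)"
    unfolding intersecting_supermodular_def
  proof (intro allI impI)
    fix Y p Z q assume h: "(Y, p) \<in> G1 \<union> G2" "(Z, q) \<in> G1 \<union> G2" "Y \<inter> Z \<noteq> {}"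
    then have "Z \<inter> Y \<noteq> {}" by blast
    consider "(Y, p) \<in> G1" "(Z, q) \<in> G1" | "(Y, p) \<in> G1" "(Z, q) \<in> G2"
      | "(Y, p) \<in> G2" "(Z, q) \<in> G1" | "(Y, p) \<in> G2" "(Z, q) \<in> G2" using h by blast
    then show "\<exists>r s. (Y \<inter> Z, r) \<in> G1 \<union> G2 \<and> (Y \<union> Z, s) \<in> G1 \<union> G2 \<and> p + q \<le> r + s"
    proof cases
      case 1 then show ?thesis using sm11[OF 1 h(3)] by blast
    next
      case 2
      then have "Y \<inter> Z = Z" "Y \<union> Z = Y" using nested12[OF 2 h(3)] by auto
      then show ?thesis using h(1,2) by (intro exI[of _ q] exI[of _ p]) simp
    next
      case 3
      then have "Y \<inter> Z = Y" "Y \<union> Z = Z" using nested12[OF 3(2,1) \<open>Z \<inter> Y \<noteq> {}\<close>] by auto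
      then show ?thesis using h(1,2) by (intro exI[of _ p] exI[of _ q]) simp
    next
      case 4
      then have "Y = Z" "p = q" using same22[OF 4 h(3)] by auto
      then show ?thesis using h(1) by (intro exI[of _ p] exI[of _ q]) simp
    qed
  qed
  moreover have "finite (G1 \<union> G2)" using finT by (simp add: G1_def G2_def)
  moreover have "Y \<subseteq> X \<and> p \<le> int (card Y) \<and> p \<le> int k" if h: "(Y, p) \<in> G1 \<union> G2" for Y p
  proof (cases "(Y, p) \<in> G1")
    case True
    then obtain U where U: "U \<noteq> {}" "U \<subseteq> T" "Y = \<delta> U" "p = int k - int (card (delta_in A tail head U))"
      using G1E by blast
    then show ?thesis using cut[OF U(1,2)] by (auto simp: \<delta>_def)
  next
    case False
    then obtain v j where "j < b v" "Y = P v j" "p = int (card (P v j))" using h G2E by blast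
    then show ?thesis using P(1)[of j v] P(2)[of j v] by auto
  qed
  ultimately have G: "colourable_demand X k (G1 \<union> G2)" by (auto simp: colourable_demand_def)
  show ?thesis
  proof (rule that[OF G])
    fix Xs :: "nat \<Rightarrow> 'e set"
    assume XsX: "\<forall>i<k. Xs i \<subseteq> X" and disj: "\<forall>i<k. \<forall>j<k. i \<noteq> j \<longrightarrow> Xs i \<inter> Xs j = {}"
      and col: "\<forall>(Y, p)\<in>G1 \<union> G2. p \<le> int (card {i. i < k \<and> Xs i \<inter> Y \<noteq> {}})"
    have finXs: "finite (Xs i)" if "i < k" for i using XsX that finX finite_subset by blast
    show "\<exists>B :: nat \<Rightarrow> 'e set. (\<forall>i<k. B i \<subseteq> A \<and> (\<forall>v\<in>T. \<exists>e\<in>Xs i. reach (B i) tail head (head e) v) \<and>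
        (\<forall>v\<in>T. b v \<le> indeg (Xs i) head v + indeg (B i) head v)) \<and>
      (\<forall>i<k. \<forall>j<k. i \<noteq> j \<longrightarrow> B i \<inter> B j = {})"
    proof (rule disjoint_b_branchings[OF finT finA arcs finXs _ _ _ b])
      show "head e \<in> T" if "i < k" "e \<in> Xs i" for i e using XsX X that by blast
      fix U assume U: "U \<noteq> {}" "U \<subseteq> T"
      have "int k - int (card (delta_in A tail head U)) \<le> int (card {i. i < k \<and> Xs i \<inter> \<delta> U \<noteq> {}})"
        using bspec[OF col UnI1[OF G1I[OF U]]] by simp
      moreover have "{i. i < k \<and> Xs i \<inter> \<delta> U \<noteq> {}} = {i. i < k \<and> head ` Xs i \<inter> U \<noteq> {}}"
        using XsX by (fastforce simp: \<delta>_def)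
      ultimately show "k \<le> card {i. i < k \<and> head ` Xs i \<inter> U \<noteq> {}} + card (delta_in A tail head U)"
        by simp
    next
      fix v assume v: "v \<in> T"
      \<comment> \<open>Colour \<open>i\<close> meets at most all \<open>b v\<close> blocks, and
        each block that it meets uses up a separate arc of that colour into
        \<open>v\<close>.\<close>
      have le: "(\<Sum>j<b v. of_bool (Xs i \<inter> P v j \<noteq> {})) \<le> min (b v) (indeg (Xs i) head v)" if i: "i < k" for i
      proof -
        have finP: "finite (Xs i \<inter> P v j)" for j using finXs[OF i] by blast
        have "(\<Sum>j<b v. of_bool (Xs i \<inter> P v j \<noteq> {})) \<le> (\<Sum>j<b v. card (Xs i \<inter> P v j))"
        proof (rule sum_mono)
          show "of_bool (Xs i \<inter> P v j \<noteq> {}) \<le> card (Xs i \<inter> P v j)" for j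
            using finP[of j] by (cases "Xs i \<inter> P v j = {}") (simp_all add: Suc_leI card_gt_0_iff)
        qed
        also have "\<dots> = card (\<Union>j<b v. Xs i \<inter> P v j)"
        proof (rule card_UN_disjoint[symmetric])
          show "\<forall>j\<in>{..<b v}. \<forall>l\<in>{..<b v}. j \<noteq> l \<longrightarrow> Xs i \<inter> P v j \<inter> (Xs i \<inter> P v l) = {}"
            using P(3) by blast
        qed (use finP in simp_all)
        also have "\<dots> \<le> indeg (Xs i) head v"
          unfolding indeg_def
        proof (rule card_mono)
          show "(\<Union>j<b v. Xs i \<inter> P v j) \<subseteq> {e \<in> Xs i. head e = v}" using P(1) by blast
        qed (use finXs[OF i] in simp)
        finally have "(\<Sum>j<b v. of_bool (Xs i \<inter> P v j \<noteq> {})) \<le> indeg (Xs i) head v" .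
        moreover have "(\<Sum>j<b v. of_bool (Xs i \<inter> P v j \<noteq> {})) \<le> (\<Sum>j<b v. 1 :: nat)"
          by (intro sum_mono) simp
        ultimately show ?thesis by simp
      qed
      \<comment> \<open>Double counting of the pairs of a block at \<open>v\<close> and a colour
        meeting it.\<close>
      have "min (indeg X head v) (b v * k) = (\<Sum>j<b v. card (P v j))"
        using P(2) by (simp add: sum_min_blocks)
      also have "\<dots> \<le> (\<Sum>j<b v. card {i. i < k \<and> Xs i \<inter> P v j \<noteq> {}})"
      proof (rule sum_mono)
        fix j assume "j \<in> {..<b v}"
        then have "(P v j, int (card (P v j))) \<in> G1 \<union> G2" using G2I[OF v] by simp
        from bspec[OF col this] show "card (P v j) \<le> card {i. i < k \<and> Xs i \<inter> P v j \<noteq> {}}" by simp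
      qed
      also have "\<dots> = (\<Sum>j<b v. \<Sum>i<k. of_bool (Xs i \<inter> P v j \<noteq> {}))"
        using card_filter_eq_sum[of "{..<k}"] by simp
      also have "\<dots> = (\<Sum>i<k. \<Sum>j<b v. of_bool (Xs i \<inter> P v j \<noteq> {}))" by (rule sum.swap)
      also have "\<dots> \<le> (\<Sum>i<k. min (b v) (indeg (Xs i) head v))" using le by (intro sum_mono) simp
      finally have "min (indeg X head v) (b v * k) \<le> (\<Sum>i<k. min (b v) (indeg (Xs i) head v))" .
      \<comment> \<open>If there are at least \<open>b v * k\<close> arcs of \<open>X\<close> into
        \<open>v\<close>, the first sum suffices alone; otherwise it accounts for all of them and
        \<open>deg\<close> supplies the rest.\<close>
      then show "k * b v \<le> (\<Sum>i<k. min (b v) (indeg (Xs i) head v)) + indeg A head v"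
        using deg[OF v] by (simp add: min_def mult.commute split: if_splits)
    qed
  qed
qed

lemma reach_reverse: "reach B head tail u v \<Longrightarrow> reach B tail head v u"
proof -
  have "arc_rel B head tail = (arc_rel B tail head)\<inverse>" by (auto simp: arc_rel_def)
  then show "reach B head tail u v \<Longrightarrow> reach B tail head v u"
    by (simp add: reach_def rtrancl_converse)
qed

section \<open>The two inequalities of the packing theorem\<close>

lemma delta_in_meets_path:
  assumes "reach B tail head u v" "u \<notin> U" "v \<in> U"
  shows "B \<inter> delta_in A tail head U \<noteq> {} \<or> \<not> B \<subseteq> A"
proof (rule ccontr)
  assume "\<not> ?thesis"
  \<comment> \<open>Without an arc of \<open>B\<close> in the cut, \<open>U\<close> is closed under
    predecessors along \<open>B\<close>, and the path can be followed back from \<open>v\<close> to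
    \<open>u\<close>.\<close>
  then have step: "head e \<in> U \<Longrightarrow> tail e \<in> U" if "e \<in> B" for e using that by (auto simp: delta_in_def)
  have "(u, v) \<in> (arc_rel B tail head)\<^sup>*" using assms(1) by (simp add: reach_def)
  then have "u \<in> U"
    by (induction rule: converse_rtrancl_induct) (use assms(3) step in \<open>auto simp: arc_rel_def\<close>)
  then show False using assms(2) by simp
qed

text \<open>A vertex of \<open>U \<subseteq> T\<close> must be reached from \<open>S\<close>, which
  lies outside \<open>U\<close>. If instead \<open>T \<subseteq> U\<close>, a vertex missing from
  \<open>U\<close> lies in \<open>S\<close> and must reach \<open>T\<close>, which lies inside
  \<open>U\<close>. Either way a path enters \<open>U\<close>.\<close>

lemma b_bibranching_meets_bicut:
  assumes "b_bibranching S T A tail head b B" "bicut_set V T U" "S \<union> T = V" "S \<inter> T = {}"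
  shows "B \<inter> delta_in A tail head U \<noteq> {}"
proof -
  have B: "B \<subseteq> A" "\<forall>v\<in>T. \<exists>s\<in>S. reach B tail head s v" "\<forall>u\<in>S. \<exists>t\<in>T. reach B tail head u t"
    using assms(1) by (auto simp: b_bibranching_def)
  have "\<exists>u v. reach B tail head u v \<and> u \<notin> U \<and> v \<in> U"
    using assms(2) unfolding bicut_set_def
  proof
    assume U: "U \<noteq> {} \<and> U \<subseteq> T"
    then obtain v where "v \<in> U" by blast
    then show ?thesis using B(2) U assms(4) by blast
  next
    assume U: "T \<subseteq> U \<and> U \<subset> V"
    then obtain u where "u \<in> V" "u \<notin> U" by blast
    then show ?thesis using B(3) U assms(3) by blast
  qed
  then show ?thesis using delta_in_meets_path B(1) by metis
qed

text \<open>Serves the degree bounds with \<open>m = b v\<close> and the bicut bound with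
  \<open>m = 1\<close>.\<close>

lemma disjoint_classes_card_le:
  fixes Bs :: "nat \<Rightarrow> 'e set"
  assumes "finite C" "\<And>i. i < k \<Longrightarrow> m \<le> card (Bs i \<inter> C)"
    and "\<And>i j. i < k \<Longrightarrow> j < k \<Longrightarrow> i \<noteq> j \<Longrightarrow> Bs i \<inter> Bs j = {}"
  shows "k * m \<le> card C"
proof -
  have "k * m = (\<Sum>i<k. m)" by simp
  also have "\<dots> \<le> (\<Sum>i<k. card (Bs i \<inter> C))" using assms(2) by (intro sum_mono) simp
  also have "\<dots> = card (\<Union>i<k. Bs i \<inter> C)"
  proof (rule card_UN_disjoint[symmetric])
    show "\<forall>i\<in>{..<k}. \<forall>j\<in>{..<k}. i \<noteq> j \<longrightarrow> Bs i \<inter> C \<inter> (Bs j \<inter> C) = {}" using assms(3) by blast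
  qed (use assms(1) in simp_all)
  also have "\<dots> \<le> card C" using assms(1) by (intro card_mono) auto
  finally show ?thesis .
qed

text \<open>The two sides are instances of the same lemma, with \<open>tail\<close> and
  \<open>head\<close> exchanged for \<open>S\<close>. Only the colouring of \<open>X\<close> has to
  suit both; a coloured arc then gives the vertices completed behind its head a source in
  \<open>S\<close> and those completed before its tail a target in \<open>T\<close>.\<close>

lemma disjoint_bibranchings_exist:
  fixes V S T :: "'v set" and A :: "'e set" and tail head :: "'e \<Rightarrow> 'v" and b :: "'v \<Rightarrow> nat"
  assumes D: "digraph V A tail head" and ST: "S \<union> T = V" "S \<inter> T = {}"
    and b: "\<forall>v\<in>V. b v > 0"
    and degT: "\<And>v. v \<in> T \<Longrightarrow> k * b v \<le> indeg A head v"
    and degS: "\<And>v. v \<in> S \<Longrightarrow> k * b v \<le> outdeg A tail v"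
    and cut: "\<And>U. bicut_set V T U \<Longrightarrow> k \<le> card (delta_in A tail head U)"
  shows "has_disjoint_bibranchings S T A tail head b k"
proof -
  define X where "X = {e\<in>A. tail e \<in> S \<and> head e \<in> T}"
  define AT where "AT = {e\<in>A. tail e \<in> T \<and> head e \<in> T}"
  define AS where "AS = {e\<in>A. tail e \<in> S \<and> head e \<in> S}"
  have fin: "finite V" "finite A" and ends: "\<And>e. e \<in> A \<Longrightarrow> tail e \<in> S \<union> T \<and> head e \<in> S \<union> T"
    using D ST by (auto simp: digraph_def)
  have finST: "finite S" "finite T" and finX: "finite X" "finite AT" "finite AS"
    using fin ST by (auto simp: X_def AT_def AS_def)
  obtain GT where GT: "colourable_demand X k GT"
    "\<And>Xs :: nat \<Rightarrow> 'e set. \<forall>i<k. Xs i \<subseteq> X \<Longrightarrow> \<forall>i<k. \<forall>j<k. i \<noteq> j \<longrightarrow> Xs i \<inter> Xs j = {} \<Longrightarrow>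
      \<forall>(Y, p)\<in>GT. p \<le> int (card {i. i < k \<and> Xs i \<inter> Y \<noteq> {}}) \<Longrightarrow>
      \<exists>B :: nat \<Rightarrow> 'e set. (\<forall>i<k. B i \<subseteq> AT \<and> (\<forall>v\<in>T. \<exists>e\<in>Xs i. reach (B i) tail head (head e) v) \<and>
        (\<forall>v\<in>T. b v \<le> indeg (Xs i) head v + indeg (B i) head v)) \<and>
      (\<forall>i<k. \<forall>j<k. i \<noteq> j \<longrightarrow> B i \<inter> B j = {})"
  proof (rule side_demand[OF finST(2) finX(1,2), of tail head k b])
    show "k \<le> card {e\<in>X. head e \<in> U} + card (delta_in AT tail head U)" if U: "U \<noteq> {}" "U \<subseteq> T" for U
    proof -
      have "delta_in A tail head U \<subseteq> {e\<in>X. head e \<in> U} \<union> delta_in AT tail head U"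
        using ends U by (auto simp: delta_in_def X_def AT_def)
      then have "card (delta_in A tail head U) \<le> card ({e\<in>X. head e \<in> U} \<union> delta_in AT tail head U)"
        using finX by (intro card_mono) (auto simp: delta_in_def)
      moreover have "k \<le> card (delta_in A tail head U)" using U by (intro cut) (simp add: bicut_set_def)
      ultimately show ?thesis using card_Un_le[of "{e\<in>X. head e \<in> U}" "delta_in AT tail head U"] by linarith
    qed
    show "k * b v \<le> indeg X head v + indeg AT head v" if v: "v \<in> T" for v
    proof -
      have "indeg A head v \<le> card ({e\<in>X. head e = v} \<union> {e\<in>AT. head e = v})"
        unfolding indeg_def using ends v fin(2) by (intro card_mono) (auto simp: X_def AT_def)
      then show ?thesis using degT[OF v] card_Un_le[of "{e\<in>X. head e = v}" "{e\<in>AT. head e = v}"]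
        by (simp add: indeg_def)
    qed
  qed (use b ST in \<open>auto simp: X_def AT_def\<close>)
  obtain GS where GS: "colourable_demand X k GS"
    "\<And>Xs :: nat \<Rightarrow> 'e set. \<forall>i<k. Xs i \<subseteq> X \<Longrightarrow> \<forall>i<k. \<forall>j<k. i \<noteq> j \<longrightarrow> Xs i \<inter> Xs j = {} \<Longrightarrow>
      \<forall>(Y, p)\<in>GS. p \<le> int (card {i. i < k \<and> Xs i \<inter> Y \<noteq> {}}) \<Longrightarrow>
      \<exists>B :: nat \<Rightarrow> 'e set. (\<forall>i<k. B i \<subseteq> AS \<and> (\<forall>v\<in>S. \<exists>e\<in>Xs i. reach (B i) head tail (tail e) v) \<and>
        (\<forall>v\<in>S. b v \<le> indeg (Xs i) tail v + indeg (B i) tail v)) \<and>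
      (\<forall>i<k. \<forall>j<k. i \<noteq> j \<longrightarrow> B i \<inter> B j = {})"
  proof (rule side_demand[OF finST(1) finX(1,3), of head tail k b])
    show "k \<le> card {e\<in>X. tail e \<in> U} + card (delta_in AS head tail U)" if U: "U \<noteq> {}" "U \<subseteq> S" for U
    proof -
      \<comment> \<open>The bicut for a set \<open>U\<close> of sources is its complement, which
        contains \<open>T\<close>: arcs entering \<open>V - U\<close> leave \<open>U\<close>, either
        towards \<open>T\<close> or, in the reversed digraph on \<open>S\<close>, as arcs entering
        \<open>U\<close>.\<close>
      have "delta_in A tail head (V - U) \<subseteq> {e\<in>X. tail e \<in> U} \<union> delta_in AS head tail U"
        using ends ST U by (auto simp: delta_in_def X_def AS_def)
      then have "card (delta_in A tail head (V - U)) \<le> card ({e\<in>X. tail e \<in> U} \<union> delta_in AS head tail U)"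
        using finX by (intro card_mono) (auto simp: delta_in_def)
      moreover have "k \<le> card (delta_in A tail head (V - U))"
        using U ST by (intro cut) (auto simp: bicut_set_def)
      ultimately show ?thesis using card_Un_le[of "{e\<in>X. tail e \<in> U}" "delta_in AS head tail U"] by linarith
    qed
    show "k * b v \<le> indeg X tail v + indeg AS tail v" if v: "v \<in> S" for v
    proof -
      have "outdeg A tail v \<le> card ({e\<in>X. tail e = v} \<union> {e\<in>AS. tail e = v})"
        unfolding outdeg_def using ends v fin(2) by (intro card_mono) (auto simp: X_def AS_def)
      then show ?thesis using degS[OF v] card_Un_le[of "{e\<in>X. tail e = v}" "{e\<in>AS. tail e = v}"]
        by (simp add: indeg_def)
    qed
  qed (use b ST in \<open>auto simp: X_def AS_def\<close>)
  obtain Xs :: "nat \<Rightarrow> 'e set" where Xs: "\<forall>i<k. Xs i \<subseteq> X" "\<forall>i<k. \<forall>j<k. i \<noteq> j \<longrightarrow> Xs i \<inter> Xs j = {}"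
    "\<forall>(Y, p)\<in>GT \<union> GS. p \<le> int (card {i. i < k \<and> Xs i \<inter> Y \<noteq> {}})"
    using supermodular_colouring[OF finX(1) GT(1) GS(1)] by (elim exE conjE)
  have col: "\<forall>(Y, p)\<in>GT. p \<le> int (card {i. i < k \<and> Xs i \<inter> Y \<noteq> {}})"
    "\<forall>(Y, p)\<in>GS. p \<le> int (card {i. i < k \<and> Xs i \<inter> Y \<noteq> {}})" using Xs(3) by blast+
  obtain BT :: "nat \<Rightarrow> 'e set" where
    BT: "\<forall>i<k. BT i \<subseteq> AT \<and> (\<forall>v\<in>T. \<exists>e\<in>Xs i. reach (BT i) tail head (head e) v) \<and>
        (\<forall>v\<in>T. b v \<le> indeg (Xs i) head v + indeg (BT i) head v)"
      "\<forall>i<k. \<forall>j<k. i \<noteq> j \<longrightarrow> BT i \<inter> BT j = {}"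
    using GT(2)[OF Xs(1,2) col(1)] by (elim exE conjE)
  obtain BS :: "nat \<Rightarrow> 'e set" where
    BS: "\<forall>i<k. BS i \<subseteq> AS \<and> (\<forall>v\<in>S. \<exists>e\<in>Xs i. reach (BS i) head tail (tail e) v) \<and>
        (\<forall>v\<in>S. b v \<le> indeg (Xs i) tail v + indeg (BS i) tail v)"
      "\<forall>i<k. \<forall>j<k. i \<noteq> j \<longrightarrow> BS i \<inter> BS j = {}"
    using GS(2)[OF Xs(1,2) col(2)] by (elim exE conjE)
  have disj3: "X \<inter> AT = {}" "X \<inter> AS = {}" "AT \<inter> AS = {}"
    using ST by (auto simp: X_def AT_def AS_def)
  define Bs where "Bs i = Xs i \<union> BT i \<union> BS i" for i
  have "b_bibranching S T A tail head b (Bs i)" if i: "i < k" for i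
  proof -
    have sub: "Xs i \<subseteq> X" "BT i \<subseteq> AT" "BS i \<subseteq> AS" using Xs(1) BT(1) BS(1) i by blast+
    then have BA: "Bs i \<subseteq> A" by (auto simp: Bs_def X_def AT_def AS_def)
    have finB: "finite (Bs i)" using BA fin(2) finite_subset by blast
    have incl: "Xs i \<subseteq> Bs i" "BT i \<subseteq> Bs i" "BS i \<subseteq> Bs i" by (auto simp: Bs_def)
    have "\<exists>s\<in>S. reach (Bs i) tail head s v" if "v \<in> T" for v
    proof -
      obtain e where e: "e \<in> Xs i" "reach (BT i) tail head (head e) v" using BT(1) i \<open>v \<in> T\<close> by blast
      have "reach (Bs i) tail head (tail e) (head e)" using e(1) incl(1) by (intro reach_arc) blast
      moreover have "reach (Bs i) tail head (head e) v" using e(2) incl(2) by (rule reach_mono)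
      ultimately have "reach (Bs i) tail head (tail e) v" by (rule reach_trans)
      moreover have "tail e \<in> S" using e(1) sub(1) by (auto simp: X_def)
      ultimately show ?thesis by blast
    qed
    moreover have "\<exists>t\<in>T. reach (Bs i) tail head u t" if "u \<in> S" for u
    proof -
      obtain e where e: "e \<in> Xs i" "reach (BS i) head tail (tail e) u" using BS(1) i \<open>u \<in> S\<close> by blast
      have "reach (Bs i) tail head (tail e) (head e)" using e(1) incl(1) by (intro reach_arc) blast
      moreover have "reach (Bs i) tail head u (tail e)"
        using reach_reverse[OF e(2)] incl(3) by (rule reach_mono)
      ultimately have "reach (Bs i) tail head u (head e)" using reach_trans by metis
      moreover have "head e \<in> T" using e(1) sub(1) by (auto simp: X_def)
      ultimately show ?thesis by blast
    qed
    moreover have degB: "b v \<le> indeg (Bs i) f v"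
      if "b v \<le> indeg (Xs i) f v + indeg C f v" "C \<subseteq> Bs i" "Xs i \<inter> C = {}" for f :: "'e \<Rightarrow> 'v" and C v
    proof -
      have "finite (Xs i)" "finite C" using incl that(2) finB finite_subset by blast+
      then have "indeg (Xs i) f v + indeg C f v = card ({e\<in>Xs i. f e = v} \<union> {e\<in>C. f e = v})"
        unfolding indeg_def using that(3) by (intro card_Un_disjoint[symmetric]) auto
      also have "\<dots> \<le> indeg (Bs i) f v"
        unfolding indeg_def using finB incl(1) that(2) by (intro card_mono) auto
      finally show ?thesis using that(1) by simp
    qed
    moreover have "b v \<le> indeg (Bs i) head v" if "v \<in> T" for v
    proof (rule degB[where C = "BT i"])
      show "b v \<le> indeg (Xs i) head v + indeg (BT i) head v" using BT(1) i that by simp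
      show "Xs i \<inter> BT i = {}" using sub disj3 by blast
    qed (rule incl)
    moreover have "b v \<le> indeg (Bs i) tail v" if "v \<in> S" for v
    proof (rule degB[where C = "BS i"])
      show "b v \<le> indeg (Xs i) tail v + indeg (BS i) tail v" using BS(1) i that by simp
      show "Xs i \<inter> BS i = {}" using sub disj3 by blast
    qed (rule incl)
    ultimately show ?thesis using BA by (simp add: b_bibranching_def indeg_def outdeg_def)
  qed
  moreover have "Bs i \<inter> Bs j = {}" if "i < k" "j < k" "i \<noteq> j" for i j
  proof -
    have "Xs i \<subseteq> X" "BT i \<subseteq> AT" "BS i \<subseteq> AS" "Xs j \<subseteq> X" "BT j \<subseteq> AT" "BS j \<subseteq> AS"
      using Xs(1) BT(1) BS(1) that by simp_all
    then have "Xs i \<inter> BT j = {}" "Xs i \<inter> BS j = {}" "BT i \<inter> BS j = {}"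
      "BT i \<inter> Xs j = {}" "BS i \<inter> Xs j = {}" "BS i \<inter> BT j = {}"
      using disj3 by (simp_all add: disjoint_iff subset_iff) metis+
    moreover have "Xs i \<inter> Xs j = {}" "BT i \<inter> BT j = {}" "BS i \<inter> BS j = {}"
      using Xs(2) BT(2) BS(2) that by simp_all
    ultimately show ?thesis by (simp add: Bs_def Int_Un_distrib Int_Un_distrib2)
  qed
  ultimately show ?thesis unfolding has_disjoint_bibranchings_def by blast
qed

theorem mainTheorem4:
  fixes V S T :: "'v set" and A :: "'e set" and tail head :: "'e \<Rightarrow> 'v" and b :: "'v \<Rightarrow> nat"
  assumes "digraph V A tail head"
    and "S \<union> T = V" and "S \<inter> T = {}" and "S \<noteq> {}" and "T \<noteq> {}"
    and "\<forall>e\<in>A. \<not> (tail e \<in> T \<and> head e \<in> S)"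
    and "\<forall>v\<in>V. b v > 0"
  shows "Max {k. has_disjoint_bibranchings S T A tail head b k} =
         min (min (Min ((\<lambda>v. indeg A head v div b v) ` T))
                  (Min ((\<lambda>v. outdeg A tail v div b v) ` S)))
             (Min {card (delta_in A tail head U) | U. bicut_set V T U})"
proof -
  let ?cuts = "{card (delta_in A tail head U) | U. bicut_set V T U}"
  define m where "m = min (min (Min ((\<lambda>v. indeg A head v div b v) ` T))
                  (Min ((\<lambda>v. outdeg A tail v div b v) ` S))) (Min ?cuts)"
  have fin: "finite V" "finite A" "finite S" "finite T"
    using assms(1,2) by (auto simp: digraph_def)
  have cuts_eq: "?cuts = (\<lambda>U. card (delta_in A tail head U)) ` {U. bicut_set V T U}" by auto
  have "{U. bicut_set V T U} \<subseteq> Pow V" using assms(2) by (auto simp: bicut_set_def)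
  then have fin_cuts: "finite ?cuts"
    unfolding cuts_eq using fin(1) by (intro finite_imageI) (metis finite_Pow_iff finite_subset)
  \<comment> \<open>A witness that the minimum over the bicuts is taken over a nonempty set.\<close>
  have "bicut_set V T T" using assms(5) by (simp add: bicut_set_def)
  then have ne_cuts: "?cuts \<noteq> {}" by blast
  have bpos: "b v > 0" if "v \<in> S \<or> v \<in> T" for v using assms(2,7) that by blast
  \<comment> \<open>Cleared of division and minima, the bound by \<open>m\<close> becomes exactly
    the conditions that every packing satisfies and that suffice to construct one.\<close>
  have le_m: "k \<le> m \<longleftrightarrow> (\<forall>v\<in>T. k * b v \<le> indeg A head v) \<and> (\<forall>v\<in>S. k * b v \<le> outdeg A tail v) \<and>
      (\<forall>U. bicut_set V T U \<longrightarrow> k \<le> card (delta_in A tail head U))" for k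
  proof -
    have "k \<le> Min ((\<lambda>v. indeg A head v div b v) ` T) \<longleftrightarrow> (\<forall>v\<in>T. k * b v \<le> indeg A head v)"
      using fin assms(5) bpos by (simp add: less_eq_div_iff_mult_less_eq)
    moreover have "k \<le> Min ((\<lambda>v. outdeg A tail v div b v) ` S) \<longleftrightarrow> (\<forall>v\<in>S. k * b v \<le> outdeg A tail v)"
      using fin assms(4) bpos by (simp add: less_eq_div_iff_mult_less_eq)
    moreover have "k \<le> Min ?cuts \<longleftrightarrow> (\<forall>U. bicut_set V T U \<longrightarrow> k \<le> card (delta_in A tail head U))"
      unfolding Min_ge_iff[OF fin_cuts ne_cuts] by blast
    ultimately show ?thesis by (simp only: m_def min.bounded_iff conj_assoc)
  qed
  have upper: "k \<le> m" if k: "has_disjoint_bibranchings S T A tail head b k" for k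
  proof -
    obtain Bs :: "nat \<Rightarrow> 'e set" where Bs: "\<And>i. i < k \<Longrightarrow> b_bibranching S T A tail head b (Bs i)"
      "\<And>i j. i < k \<Longrightarrow> j < k \<Longrightarrow> i \<noteq> j \<Longrightarrow> Bs i \<inter> Bs j = {}"
      using k unfolding has_disjoint_bibranchings_def by blast
    have BA: "Bs i \<subseteq> A" if "i < k" for i using Bs(1)[OF that] by (simp add: b_bibranching_def)
    have inter: "Bs i \<inter> {e\<in>A. f e = v} = {e\<in>Bs i. f e = v}" if "i < k" for i v and f :: "'e \<Rightarrow> 'v"
      using BA[OF that] by blast
    have "k * b v \<le> indeg A head v" if "v \<in> T" for v
      unfolding indeg_def
    proof (rule disjoint_classes_card_le[where Bs = Bs])
      show "b v \<le> card (Bs i \<inter> {e\<in>A. head e = v})" if "i < k" for i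
        using Bs(1)[OF that] \<open>v \<in> T\<close> inter[OF that] by (simp add: b_bibranching_def indeg_def)
    qed (use fin Bs(2) in auto)
    moreover have "k * b v \<le> outdeg A tail v" if "v \<in> S" for v
      unfolding outdeg_def
    proof (rule disjoint_classes_card_le[where Bs = Bs])
      show "b v \<le> card (Bs i \<inter> {e\<in>A. tail e = v})" if "i < k" for i
        using Bs(1)[OF that] \<open>v \<in> S\<close> inter[OF that] by (simp add: b_bibranching_def outdeg_def)
    qed (use fin Bs(2) in auto)
    moreover have "k \<le> card (delta_in A tail head U)" if "bicut_set V T U" for U
    proof -
      have finC: "finite (delta_in A tail head U)" using fin(2) by (simp add: delta_in_def)
      have "k * 1 \<le> card (delta_in A tail head U)"
      proof (rule disjoint_classes_card_le[where Bs = Bs, OF finC])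
        show "1 \<le> card (Bs i \<inter> delta_in A tail head U)" if "i < k" for i
          using b_bibranching_meets_bicut[OF Bs(1)[OF that] \<open>bicut_set V T U\<close> assms(2,3)] finC
          by (simp add: Suc_leI card_gt_0_iff)
      qed (use Bs(2) in blast)
      then show ?thesis by simp
    qed
    ultimately show ?thesis unfolding le_m by blast
  qed
  have "has_disjoint_bibranchings S T A tail head b m"
    by (rule disjoint_bibranchings_exist[OF assms(1-3,7)]) (use le_m[of m] in blast)+
  moreover have "finite {k. has_disjoint_bibranchings S T A tail head b k}"
    by (rule finite_subset[of _ "{..m}"]) (use upper in auto)
  ultimately show ?thesis unfolding m_def[symmetric] using upper by (intro Max_eqI) simp_all
qed

end
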